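(* Let $\mathcal R\subset\mathbb R^N$ be a Coxeter root system, $g$ a $W$-invariant multiplicity function, $\gamma\in\mathbb C$. Define the components of the Dunkl Laplace–Runge–Lenz vector by $$A_i=-\frac12\sum_{j=1}^N\{L_{ij},\nabla_j\}+\frac12[\nabla_i,S]-\frac{\gamma x_i}{r},\qquad i=1,\dots,N,$$ and the Dunkl–Coulomb Hamiltonian by $\mathcal H_\gamma=\nabla^2+\frac{2\gamma}{r}$. Then $$[A_i,\mathcal H_\gamma]=0$$ for any $i=1,\dots,N$.
   Context: $\mathcal R\subset\mathbb R^N$ is a finite set of nonzero vectors with $\mathcal R\cap\mathbb R\alpha=\{\pm\alpha\}$ and $s_\alpha\mathcal R=\mathcal R$ for all $\alpha\in\mathcal R$, where $s_\alpha(x)=x-\frac{2(\alpha,x)}{(\alpha,\alpha)}\alpha$; $W$ is the finite group generated by the $s_\alpha$; $\mathcal R_+$ is a choice of positive roots. $g:\mathcal R\to\mathbb C$, $g_\alpha=g(\alpha)$, satisfies $g_{w(\alpha)}=g_\alpha$. All operators act on functions $\psi(x)$ of $x=(x_1,\dots,x_N)$ (e.g. smooth complex functions on $\{x\in\mathbb R^N: x\ne0,\ (\alpha,x)\neq0\ \forall\alpha\in\mathcal R\}$), with $s_\alpha\psi(x)=\psi(s_\alpha(x))$. Dunkl operators: $\nabla_i=\partial_{x_i}-\sum_{\alpha\in\mathcal R_+}\frac{g_\alpha\alpha_i}{(\alpha,x)}s_\alpha$; they commute pairwise. $\nabla^2=\sum_{i=1}^N\nabla_i^2$, which equals $\Delta-\sum_{\alpha\in\mathcal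 R_+}\frac{g_\alpha(g_\alpha-s_\alpha)(\alpha,\alpha)}{(\alpha,x)^2}$ with $\Delta$ the Laplace operator. Dunkl angular momenta: $L_{ij}=x_i\nabla_j-x_j\nabla_i$. $S=-\sum_{\alpha\in\mathcal R_+}g_\alpha s_\alpha$, $r=(\sum_kx_k^2)^{1/2}$. $[a,b]=ab-ba$, $\{a,b\}=ab+ba$. *)

theory Defs
  imports "HOL-Analysis.Analysis" "HOL-Algebra.Bij" "HOL-Algebra.Generated_Groups"
begin

definition root_reflection :: "real ^ 'n \<Rightarrow> real ^ 'n \<Rightarrow> real ^ 'n" where
  "root_reflection \<alpha> x = x - (2 * (\<alpha> \<bullet> x) / (\<alpha> \<bullet> \<alpha>)) *\<^sub>R \<alpha>"

definition root_system :: "(real ^ 'n) set \<Rightarrow> bool" where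
  "root_system R \<longleftrightarrow>
     finite R \<and> 0 \<notin> R \<and>
     (\<forall>\<alpha>\<in>R. R \<inter> range (\<lambda>c. c *\<^sub>R \<alpha>) = {\<alpha>, - \<alpha>}) \<and>
     (\<forall>\<alpha>\<in>R. root_reflection \<alpha> ` R = R)"

definition positive_roots :: "(real ^ 'n) set \<Rightarrow> (real ^ 'n) set \<Rightarrow> bool" where
  "positive_roots R P \<longleftrightarrow>
     (\<exists>v. (\<forall>\<alpha>\<in>R. v \<bullet> \<alpha> \<noteq> 0) \<and> P = {\<alpha> \<in> R. v \<bullet> \<alpha> > 0})"

definition reflection_group :: "(real ^ 'n) set \<Rightarrow> (real ^ 'n \<Rightarrow> real ^ 'n) set" where
  "reflection_group R = generate (BijGroup UNIV) (root_reflection ` R)"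

definition multiplicity_function :: "(real ^ 'n) set \<Rightarrow> (real ^ 'n \<Rightarrow> complex) \<Rightarrow> bool" where
  "multiplicity_function R g \<longleftrightarrow> (\<forall>w\<in>reflection_group R. \<forall>\<alpha>\<in>R. g (w \<alpha>) = g \<alpha>)"

definition regular_set :: "(real ^ 'n) set \<Rightarrow> (real ^ 'n) set" where
  "regular_set R = {x. x \<noteq> 0 \<and> (\<forall>\<alpha>\<in>R. \<alpha> \<bullet> x \<noteq> 0)}"

(* C^k on an open set U: derivatives in all directions, iterated k times, exist and are continuous. *)
fun Ck_on :: "nat \<Rightarrow> (real ^ 'n) set \<Rightarrow> (real ^ 'n \<Rightarrow> complex) \<Rightarrow> bool" where
  "Ck_on 0 U f \<longleftrightarrow> continuous_on U f"
| "Ck_on (Suc k) U f \<longleftrightarrow>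
     (\<forall>x\<in>U. f differentiable (at x)) \<and>
     (\<forall>v. Ck_on k U (\<lambda>x. frechet_derivative f (at x) v))"

definition smooth_on :: "(real ^ 'n) set \<Rightarrow> (real ^ 'n \<Rightarrow> complex) \<Rightarrow> bool" where
  "smooth_on U f \<longleftrightarrow> (\<forall>k. Ck_on k U f)"

(* Operators act on total functions; only their values on the regular set are meaningful.
   That set is open and stable under the reflections, so these values depend only on the
   restriction of the argument to it. *)
type_synonym 'n operator = "(real ^ 'n \<Rightarrow> complex) \<Rightarrow> real ^ 'n \<Rightarrow> complex"

definition comm :: "'n operator \<Rightarrow> 'n operator \<Rightarrow> 'n operator" where
  "comm A B \<psi> x = A (B \<psi>) x - B (A \<psi>) x"

definition acomm :: "'n operator \<Rightarrow> 'n operator \<Rightarrow> 'n operator" where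
  "acomm A B \<psi> x = A (B \<psi>) x + B (A \<psi>) x"

definition partial :: "'n::finite \<Rightarrow> 'n operator" where
  "partial i \<psi> x = vector_derivative (\<lambda>t. \<psi> (x + t *\<^sub>R axis i 1)) (at 0)"

definition dunkl :: "(real ^ 'n) set \<Rightarrow> (real ^ 'n \<Rightarrow> complex) \<Rightarrow> 'n::finite \<Rightarrow> 'n operator" where
  "dunkl P g i \<psi> x =
     partial i \<psi> x
     - (\<Sum>\<alpha>\<in>P. g \<alpha> * of_real (\<alpha> $ i) / of_real (\<alpha> \<bullet> x) * \<psi> (root_reflection \<alpha> x))"

definition dunkl_laplacian :: "(real ^ 'n) set \<Rightarrow> (real ^ 'n \<Rightarrow> complex) \<Rightarrow> 'n::finite operator" where
  "dunkl_laplacian P g \<psi> x = (\<Sum>i\<in>UNIV. dunkl P g i (dunkl P g i \<psi>) x)"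

definition dunkl_angular ::
  "(real ^ 'n) set \<Rightarrow> (real ^ 'n \<Rightarrow> complex) \<Rightarrow> 'n::finite \<Rightarrow> 'n \<Rightarrow> 'n operator" where
  "dunkl_angular P g i j \<psi> x =
     of_real (x $ i) * dunkl P g j \<psi> x - of_real (x $ j) * dunkl P g i \<psi> x"

definition dunkl_S :: "(real ^ 'n) set \<Rightarrow> (real ^ 'n \<Rightarrow> complex) \<Rightarrow> 'n::finite operator" where
  "dunkl_S P g \<psi> x = - (\<Sum>\<alpha>\<in>P. g \<alpha> * \<psi> (root_reflection \<alpha> x))"

definition dunkl_LRL ::
  "(real ^ 'n) set \<Rightarrow> (real ^ 'n \<Rightarrow> complex) \<Rightarrow> complex \<Rightarrow> 'n::finite \<Rightarrow> 'n operator" where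
  "dunkl_LRL P g \<gamma> i \<psi> x =
     - (1 / 2) * (\<Sum>j\<in>UNIV. acomm (dunkl_angular P g i j) (dunkl P g j) \<psi> x)
     + (1 / 2) * comm (dunkl P g i) (dunkl_S P g) \<psi> x
     - \<gamma> * of_real (x $ i) / of_real (norm x) * \<psi> x"

definition dunkl_coulomb ::
  "(real ^ 'n) set \<Rightarrow> (real ^ 'n \<Rightarrow> complex) \<Rightarrow> complex \<Rightarrow> 'n::finite operator" where
  "dunkl_coulomb P g \<gamma> \<psi> x =
     dunkl_laplacian P g \<psi> x + 2 * \<gamma> / of_real (norm x) * \<psi> x"

end

theory Submission
  imports Defs
begin

text \<open>
  Write \<open>e = \<Sum>\<^sub>j x\<^sub>j \<partial>\<^sub>j\<close> for the Euler operator and \<open>\<rho> = 1 / r\<close>. Since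
  \<open>e = x \<bullet> \<nabla> - S\<close>, the Laplace--Runge--Lenz vector becomes
  \<open>A\<^sub>i = - x\<^sub>i \<nabla>\<^sup>2 + (e + (N - 1) / 2) \<nabla>\<^sub>i - \<gamma> x\<^sub>i \<rho>\<close>, and the claim is a short
  computation from \<open>[\<nabla>\<^sup>2, x\<^sub>i] = 2 \<nabla>\<^sub>i\<close>, \<open>[\<nabla>\<^sub>i, e] = \<nabla>\<^sub>i\<close>, \<open>[\<nabla>\<^sup>2, \<nabla>\<^sub>i] = 0\<close> and
  \<open>[\<nabla>\<^sup>2, \<rho>] = - 2 \<rho>\<^sup>3 e + (3 - N) \<rho>\<^sup>3\<close>.

  For the commutativity of the Dunkl operators: by the symmetry of second derivatives,
  \<open>[\<nabla>\<^sub>v, \<nabla>\<^sub>w] f (x)\<close> is a linear combination of the values of \<open>f\<close> at finitely many points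
  different from \<open>x\<close>, and \<open>[\<nabla>\<^sub>v, \<nabla>\<^sub>w]\<close> commutes with multiplication by polynomials;
  multiplying \<open>f\<close> by a polynomial that vanishes at those points but not at \<open>x\<close> shows that
  the value is zero.
\<close>

section \<open>Smooth functions\<close>

text \<open>The mean value theorem, applied once along \<open>v\<close> and once along
  \<open>w\<close>, turns the second difference quotient into a value of \<open>G y w\<close> at a
  point near \<open>x\<close>; continuity at \<open>x\<close> gives the limit. Equal step lengths
  make the quotient symmetric in \<open>v\<close> and \<open>w\<close>, which is what the symmetry
  of second derivatives uses.\<close>

lemma second_difference_tendsto:
  fixes F :: "'a::real_normed_vector \<Rightarrow> real"
  assumes U: "open U" "x \<in> U"
    and F: "\<And>y. y \<in> U \<Longrightarrow> (F has_derivative F' y) (at y)"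
    and G: "\<And>y. y \<in> U \<Longrightarrow> ((\<lambda>y. F' y v) has_derivative G y) (at y)"
    and cont: "isCont (\<lambda>y. G y w) x"
  shows "((\<lambda>t. (F (x + t *\<^sub>R v + t *\<^sub>R w) - F (x + t *\<^sub>R v) - F (x + t *\<^sub>R w) + F x) / t\<^sup>2)
    \<longlongrightarrow> G x w) (at_right 0)"
proof (rule tendstoI)
  fix e :: real assume e: "e > 0"
  obtain d1 where d1: "d1 > 0" "\<And>y. dist y x < d1 \<Longrightarrow> y \<in> U"
    using U by (meson open_dist)
  obtain d2 where d2: "d2 > 0" "\<And>y. dist y x < d2 \<Longrightarrow> dist (G y w) (G x w) < e"
    using cont e unfolding continuous_at_eps_delta by blast
  \<comment> \<open>Moving by at most \<open>t\<close> along each direction displaces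
    \<open>x\<close> by at most \<open>t * k\<close>; the summand 1 keeps \<open>k\<close> positive
    when both directions vanish.\<close>
  define k where "k = norm v + norm w + 1"
  have k: "k > 0" by (simp add: k_def add_nonneg_pos)
  define d where "d = min d1 d2 / k"
  have d: "d > 0" using d1 d2 k by (simp add: d_def)
  have near: "dist (x + a *\<^sub>R v + b *\<^sub>R w) x < min d1 d2"
    if "0 \<le> a" "a \<le> t" "0 \<le> b" "b \<le> t" "t < d" for a b t
  proof -
    have "dist (x + a *\<^sub>R v + b *\<^sub>R w) x \<le> a * norm v + b * norm w"
      using that norm_triangle_ineq[of "a *\<^sub>R v" "b *\<^sub>R w"] by (simp add: dist_norm)
    also have "\<dots> \<le> t * norm v + t * norm w"
      using that by (intro add_mono mult_right_mono) auto
    also have "\<dots> \<le> t * k" using that by (simp add: k_def algebra_simps)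
    also have "\<dots> < d * k" using that k by simp
    finally show ?thesis using k by (simp add: d_def)
  qed
  have "dist ((F (x + t *\<^sub>R v + t *\<^sub>R w) - F (x + t *\<^sub>R v) - F (x + t *\<^sub>R w) + F x) / t\<^sup>2) (G x w) < e"
    if t: "0 < t" "t < d" for t
  proof -
    have inU: "x + a *\<^sub>R v + b *\<^sub>R w \<in> U" if "0 \<le> a" "a \<le> t" "0 \<le> b" "b \<le> t" for a b
      using near[OF that] t d1 by auto
    \<comment> \<open>First use of the mean value theorem: the increment in direction
      \<open>w\<close> is regarded as a function of the coordinate along \<open>v\<close>.\<close>
    have "\<exists>s. 0 < s \<and> s < t \<and>
       (F (x + t *\<^sub>R v + t *\<^sub>R w) - F (x + t *\<^sub>R v)) - (F (x + 0 *\<^sub>R v + t *\<^sub>R w) - F (x + 0 *\<^sub>R v))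
       = (t - 0) * (F' (x + s *\<^sub>R v + t *\<^sub>R w) v - F' (x + s *\<^sub>R v) v)"
    proof (rule MVT2[OF \<open>0 < t\<close>])
      fix s assume s: "0 \<le> s" "s \<le> t"
      have m1: "x + s *\<^sub>R v + t *\<^sub>R w \<in> U" and m2: "x + s *\<^sub>R v \<in> U"
        using inU[of s t] inU[of s 0] s t by auto
      have "((\<lambda>s. F (x + s *\<^sub>R v + t *\<^sub>R w) - F (x + s *\<^sub>R v)) has_derivative
        (\<lambda>h. F' (x + s *\<^sub>R v + t *\<^sub>R w) (h *\<^sub>R v) - F' (x + s *\<^sub>R v) (h *\<^sub>R v))) (at s)"
        by (rule has_derivative_diff; rule has_derivative_compose[OF _ F])
           (auto intro!: derivative_eq_intros m1 m2)
      also have "(\<lambda>h. F' (x + s *\<^sub>R v + t *\<^sub>R w) (h *\<^sub>R v) - F' (x + s *\<^sub>R v) (h *\<^sub>R v))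
        = (*) (F' (x + s *\<^sub>R v + t *\<^sub>R w) v - F' (x + s *\<^sub>R v) v)"
        using F[OF m1, THEN has_derivative_linear] F[OF m2, THEN has_derivative_linear]
        by (simp add: linear_scale fun_eq_iff algebra_simps)
      finally show "((\<lambda>s. F (x + s *\<^sub>R v + t *\<^sub>R w) - F (x + s *\<^sub>R v)) has_real_derivative
        F' (x + s *\<^sub>R v + t *\<^sub>R w) v - F' (x + s *\<^sub>R v) v) (at s)"
        unfolding has_field_derivative_def .
    qed
    then obtain s where s: "0 < s" "s < t"
      "F (x + t *\<^sub>R v + t *\<^sub>R w) - F (x + t *\<^sub>R v) - F (x + t *\<^sub>R w) + F x
       = t * (F' (x + s *\<^sub>R v + t *\<^sub>R w) v - F' (x + s *\<^sub>R v) v)" by auto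
    \<comment> \<open>Second use: \<open>s\<close> stays fixed and the coordinate along
      \<open>w\<close> varies.\<close>
    have "\<exists>u. 0 < u \<and> u < t \<and>
       F' (x + s *\<^sub>R v + t *\<^sub>R w) v - F' (x + s *\<^sub>R v + 0 *\<^sub>R w) v
         = (t - 0) * G (x + s *\<^sub>R v + u *\<^sub>R w) w"
    proof (rule MVT2[OF \<open>0 < t\<close>])
      fix u assume u: "0 \<le> u" "u \<le> t"
      have m: "x + s *\<^sub>R v + u *\<^sub>R w \<in> U" using inU[of s u] s u by auto
      have "((\<lambda>u. F' (x + s *\<^sub>R v + u *\<^sub>R w) v) has_derivative
        (\<lambda>h. G (x + s *\<^sub>R v + u *\<^sub>R w) (h *\<^sub>R w))) (at u)"
        by (rule has_derivative_compose[OF _ G]) (auto intro!: derivative_eq_intros m)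
      also have "(\<lambda>h. G (x + s *\<^sub>R v + u *\<^sub>R w) (h *\<^sub>R w)) = (*) (G (x + s *\<^sub>R v + u *\<^sub>R w) w)"
        using G[OF m, THEN has_derivative_linear] by (simp add: linear_scale fun_eq_iff)
      finally show "((\<lambda>u. F' (x + s *\<^sub>R v + u *\<^sub>R w) v) has_real_derivative G (x + s *\<^sub>R v + u *\<^sub>R w) w) (at u)"
        unfolding has_field_derivative_def .
    qed
    then obtain u where u: "0 < u" "u < t"
      "F' (x + s *\<^sub>R v + t *\<^sub>R w) v - F' (x + s *\<^sub>R v) v = t * G (x + s *\<^sub>R v + u *\<^sub>R w) w" by auto
    have "(F (x + t *\<^sub>R v + t *\<^sub>R w) - F (x + t *\<^sub>R v) - F (x + t *\<^sub>R w) + F x) / t\<^sup>2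
      = G (x + s *\<^sub>R v + u *\<^sub>R w) w"
      unfolding s u using t by (simp add: power2_eq_square)
    then show ?thesis using near[of s t u] s u t d2 by simp
  qed
  then show "\<forall>\<^sub>F t in at_right 0. dist ((F (x + t *\<^sub>R v + t *\<^sub>R w) - F (x + t *\<^sub>R v) - F (x + t *\<^sub>R w) + F x) / t\<^sup>2) (G x w) < e"
    unfolding eventually_at_right_field using d by (auto intro!: exI[of _ d])
qed

text \<open>Both mixed derivatives are limits of one and the same second difference
  quotient.\<close>

lemma second_derivative_symmetric_real:
  fixes F :: "'a::real_normed_vector \<Rightarrow> real"
  assumes U: "open U" "x \<in> U"
    and F: "\<And>y. y \<in> U \<Longrightarrow> (F has_derivative F' y) (at y)"
    and G: "\<And>y. y \<in> U \<Longrightarrow> ((\<lambda>y. F' y v) has_derivative G y) (at y)"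
    and H: "\<And>y. y \<in> U \<Longrightarrow> ((\<lambda>y. F' y w) has_derivative H y) (at y)"
    and cont: "isCont (\<lambda>y. G y w) x" "isCont (\<lambda>y. H y v) x"
  shows "G x w = H x v"
proof (rule tendsto_unique[OF trivial_limit_at_right_real])
  show "((\<lambda>t. (F (x + t *\<^sub>R v + t *\<^sub>R w) - F (x + t *\<^sub>R v) - F (x + t *\<^sub>R w) + F x) / t\<^sup>2)
    \<longlongrightarrow> G x w) (at_right 0)"
    by (rule second_difference_tendsto[OF U F G cont(1)])
  show "((\<lambda>t. (F (x + t *\<^sub>R v + t *\<^sub>R w) - F (x + t *\<^sub>R v) - F (x + t *\<^sub>R w) + F x) / t\<^sup>2)
    \<longlongrightarrow> H x v) (at_right 0)"
    using second_difference_tendsto[OF U F H cont(2)] by (simp add: algebra_simps)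
qed

section \<open>Calculus of \<open>Ck_on\<close> and \<open>smooth_on\<close>\<close>

abbreviation fd :: "(real ^ 'n \<Rightarrow> complex) \<Rightarrow> real ^ 'n \<Rightarrow> real ^ 'n \<Rightarrow> complex" where
  "fd f x \<equiv> frechet_derivative f (at x)"

lemma fd_has_derivative:
  "(f has_derivative f') (at x) \<Longrightarrow> fd f x v = f' v"
  by (simp add: frechet_derivative_at[symmetric])

lemma fd_cong:
  assumes "open U" "x \<in> U" "\<And>y. y \<in> U \<Longrightarrow> f y = g y"
  shows "fd f x v = fd g x v"
proof -
  \<comment> \<open>The two functions have the same candidate derivatives, so the choice made by
    \<open>frechet_derivative\<close> agrees even where none exists.\<close>
  have "(f has_derivative h) (at x) = (g has_derivative h) (at x)" for h
    using has_derivative_transform_within_open[of _ h x UNIV U] assms by metis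
  then show ?thesis by (simp add: frechet_derivative_def)
qed

lemma differentiable_cong_open:
  assumes "open U" "x \<in> U" "\<And>y. y \<in> U \<Longrightarrow> f y = g y"
  shows "f differentiable (at x) \<longleftrightarrow> g differentiable (at x)"
  using has_derivative_transform_within_open[of _ _ x UNIV U] assms
  unfolding differentiable_def by metis

lemma Ck_on_cong:
  assumes "open U" "\<And>y. y \<in> U \<Longrightarrow> f y = g y"
  shows "Ck_on k U f = Ck_on k U g"
  using assms
proof (induction k arbitrary: f g)
  case 0
  then show ?case using continuous_on_cong[of U U f g] by simp
next
  case (Suc k)
  have "Ck_on k U (\<lambda>x. fd f x v) = Ck_on k U (\<lambda>x. fd g x v)" for v
    by (rule Suc.IH[OF \<open>open U\<close>], rule fd_cong[OF \<open>open U\<close>]) (auto simp: Suc.prems)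
  moreover have "f differentiable (at x) \<longleftrightarrow> g differentiable (at x)" if "x \<in> U" for x
    by (rule differentiable_cong_open[OF Suc.prems(1) that]) (rule Suc.prems(2))
  ultimately show ?case by simp
qed

text \<open>Replaces the chosen derivative in \<open>Ck_on\<close> by an explicit formula; the
  inductive closure properties below rest on it.\<close>

lemma Ck_on_SucI:
  assumes "open U" "\<And>x. x \<in> U \<Longrightarrow> (f has_derivative f' x) (at x)"
    "\<And>v. Ck_on k U (\<lambda>x. f' x v)"
  shows "Ck_on (Suc k) U f"
proof -
  have "Ck_on k U (\<lambda>x. fd f x v) = Ck_on k U (\<lambda>x. f' x v)" for v
    by (rule Ck_on_cong[OF assms(1)], rule fd_has_derivative, rule assms(2))
  then show ?thesis using assms by (auto simp: differentiable_def)
qed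

lemma Ck_on_mono: "Ck_on (Suc k) U f \<Longrightarrow> Ck_on k U f"
proof (induction k arbitrary: f)
  case 0
  then show ?case
    by (auto intro!: continuous_at_imp_continuous_on differentiable_imp_continuous_within)
next
  case (Suc k)
  have "Ck_on (Suc k) U (\<lambda>x. fd f x v)" for v
    using Suc.prems by (subst (asm) Ck_on.simps) blast
  then show ?case using Suc.IH Suc.prems unfolding Ck_on.simps by blast
qed

lemma Ck_on_has_derivative:
  assumes "Ck_on (Suc k) U f" "x \<in> U"
  shows "(f has_derivative (\<lambda>v. fd f x v)) (at x)"
  using assms by (simp add: frechet_derivative_works[symmetric])

lemma Ck_on_const: "open U \<Longrightarrow> Ck_on k U (\<lambda>x. c)"
proof (induction k arbitrary: c)
  case (Suc k)
  show ?case by (rule Ck_on_SucI[OF Suc.prems], rule has_derivative_const) (use Suc in auto)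
qed simp

lemma Ck_on_add:
  assumes "open U" "Ck_on k U f" "Ck_on k U g"
  shows "Ck_on k U (\<lambda>x. f x + g x)"
  using assms(2,3)
proof (induction k arbitrary: f g)
  case (Suc k)
  show ?case
    by (rule Ck_on_SucI[OF assms(1)], rule has_derivative_add)
       (use Suc in \<open>auto intro: Ck_on_has_derivative simp del: Ck_on.simps intro!: Suc.IH\<close>, (simp)+)
qed (simp add: continuous_on_add)

lemma Ck_on_mult:
  assumes "open U" "Ck_on k U f" "Ck_on k U g"
  shows "Ck_on k U (\<lambda>x. f x * g x)"
  using assms(2,3)
proof (induction k arbitrary: f g)
  case (Suc k)
  show ?case
  proof (rule Ck_on_SucI[OF assms(1)])
    show "((\<lambda>x. f x * g x) has_derivative (\<lambda>v. f x * fd g x v + fd f x v * g x)) (at x)"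
      if "x \<in> U" for x
      by (rule has_derivative_mult) (use Suc.prems that in \<open>auto intro: Ck_on_has_derivative simp del: Ck_on.simps\<close>)
    show "Ck_on k U (\<lambda>x. f x * fd g x v + fd f x v * g x)" for v
      using Suc.prems Suc.prems[THEN Ck_on_mono] by (intro Ck_on_add Suc.IH assms(1)) simp_all
  qed
qed (simp add: continuous_on_mult)

lemma Ck_on_inner: 
  assumes "open U" shows "Ck_on k U (\<lambda>x. of_real (u \<bullet> x))"
proof (cases k)
  case (Suc n)
  show ?thesis unfolding Suc
    by (rule Ck_on_SucI[OF assms, where f' = "\<lambda>x v. of_real (u \<bullet> v)"])
       (auto intro!: derivative_eq_intros Ck_on_const assms)
qed (auto intro!: continuous_intros)

text \<open>The derivative of the inverse is a product of \<open>fd f\<close> and the inverse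
  itself, so the induction hypothesis and closure under products suffice.\<close>

lemma Ck_on_inverse:
  assumes "open U" "\<And>x. x \<in> U \<Longrightarrow> f x \<noteq> 0" "Ck_on k U f"
  shows "Ck_on k U (\<lambda>x. inverse (f x))"
  using assms(3)
proof (induction k)
  case (Suc k)
  show ?case
  proof (rule Ck_on_SucI[OF assms(1)])
    show "((\<lambda>x. inverse (f x)) has_derivative (\<lambda>v. - (inverse (f x) * fd f x v * inverse (f x)))) (at x)" 
      if "x \<in> U" for x
      by (rule Deriv.has_derivative_inverse)
         (use assms(2) Suc.prems that in \<open>auto intro: Ck_on_has_derivative simp del: Ck_on.simps\<close>)
    have "Ck_on k U (\<lambda>x. -1 * (inverse (f x) * fd f x v * inverse (f x)))" for v
      using Suc.prems Suc.prems[THEN Ck_on_mono] Suc.IH 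
      by (intro Ck_on_mult Ck_on_const assms(1)) simp_all
    then show "Ck_on k U (\<lambda>x. - (inverse (f x) * fd f x v * inverse (f x)))" for v by simp
  qed
qed (use assms in \<open>simp add: continuous_on_inverse\<close>)

text \<open>The derivative in direction \<open>v\<close> is again a composite with \<open>L\<close>,
  of the function \<open>fd f y (L v)\<close> of \<open>y\<close>; the induction therefore runs over
  all \<open>f\<close>.\<close>

lemma Ck_on_compose_linear:
  assumes "open U" "bounded_linear L" "\<And>x. x \<in> U \<Longrightarrow> L x \<in> U" "Ck_on k U f"
  shows "Ck_on k U (\<lambda>x. f (L x))"
  using assms(4)
proof (induction k arbitrary: f)
  case 0
  then show ?case using assms
    by (auto intro!: continuous_on_compose2[of U f U L] linear_continuous_on[OF assms(2)])
next
  case (Suc k)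
  show ?case
  proof (rule Ck_on_SucI[OF assms(1)])
    show "((\<lambda>x. f (L x)) has_derivative (\<lambda>v. fd f (L x) (L v))) (at x)" if "x \<in> U" for x
      by (rule has_derivative_compose[OF bounded_linear_imp_has_derivative[OF assms(2)]])
         (use Suc.prems that assms(3) in \<open>auto intro: Ck_on_has_derivative simp del: Ck_on.simps\<close>)
    show "Ck_on k U (\<lambda>x. fd f (L x) (L v))" for v
      using Suc.prems by (intro Suc.IH) simp
  qed
qed

lemma has_derivative_inverse_norm:
  fixes x :: "'a::real_inner"
  assumes "x \<noteq> 0"
  shows "((\<lambda>x. 1 / complex_of_real (norm x)) has_derivative
    (\<lambda>v. - of_real (v \<bullet> x) * (1 / of_real (norm x)) ^ 3)) (at x)"
proof -
  have "((\<lambda>x. 1 / norm x) has_derivative (\<lambda>v. - (v \<bullet> x / norm x ^ 3))) (at x)"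
    using assms by (auto intro!: derivative_eq_intros has_derivative_norm
        simp: sgn_div_norm fun_eq_iff inner_commute divide_simps power3_eq_cube)
  from has_derivative_of_real[OF this, where 'a = complex] show ?thesis
    by (simp add: power_divide)
qed

text \<open>By \<open>has_derivative_inverse_norm\<close> the derivative is a linear function times
  the cube of the function itself, which closes the induction.\<close>

lemma Ck_on_inverse_norm:
  assumes "open U" "0 \<notin> U"
  shows "Ck_on k U (\<lambda>x. 1 / of_real (norm x))"
proof (induction k)
  case 0
  then show ?case using assms by (auto intro!: continuous_intros)
next
  case (Suc k)
  let ?r = "\<lambda>x::real^'n. 1 / complex_of_real (norm x)"
  show ?case
  proof (rule Ck_on_SucI[OF assms(1)])
    show "(?r has_derivative (\<lambda>v. - of_real (v \<bullet> x) * ?r x ^ 3)) (at x)" if "x \<in> U" for x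
      using that assms by (intro has_derivative_inverse_norm) auto
    have "Ck_on k U (\<lambda>x. of_real (v \<bullet> x) * (-1 * (?r x * (?r x * ?r x))))" for v
      by (intro Ck_on_mult Ck_on_inner Ck_on_const assms(1) Suc)
    then show "Ck_on k U (\<lambda>x. - of_real (v \<bullet> x) * ?r x ^ 3)" for v
      by (simp add: power3_eq_cube mult.assoc)
  qed
qed

lemma smooth_on_cong:
  assumes "open U" "\<And>y. y \<in> U \<Longrightarrow> f y = g y"
  shows "smooth_on U f = smooth_on U g"
  unfolding smooth_on_def using Ck_on_cong[OF assms] by simp

lemma smooth_on_fd:
  assumes "smooth_on U f" shows "smooth_on U (\<lambda>x. fd f x v)"
  unfolding smooth_on_def
proof
  fix k show "Ck_on k U (\<lambda>x. fd f x v)"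
    using assms[unfolded smooth_on_def, rule_format, of "Suc k"] by simp
qed

lemma smooth_on_has_derivative:
  "smooth_on U f \<Longrightarrow> x \<in> U \<Longrightarrow> (f has_derivative (\<lambda>v. fd f x v)) (at x)"
  unfolding smooth_on_def by (blast intro: Ck_on_has_derivative)

lemma smooth_on_sum:
  assumes "open U" "\<And>a. a \<in> A \<Longrightarrow> smooth_on U (f a)"
  shows "smooth_on U (\<lambda>x. \<Sum>a\<in>A. f a x)"
  using assms(2)
  by (induction A rule: infinite_finite_induct)
     (auto simp: smooth_on_def intro!: Ck_on_const Ck_on_add assms(1))

text \<open>Real and imaginary parts are treated separately, since the real version rests on the
  mean value theorem.\<close>

lemma second_derivative_symmetric:
  assumes U: "open U" "x \<in> U" and f: "smooth_on U f"
  shows "fd (\<lambda>y. fd f y v) x w = fd (\<lambda>y. fd f y w) x v"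
proof (rule complex_eqI)
  note D1 = smooth_on_has_derivative[OF f]
  note D2 = smooth_on_has_derivative[OF smooth_on_fd[OF f]]
  have C: "isCont (\<lambda>y. fd (\<lambda>y. fd f y a) y b) x" for a b
    using smooth_on_fd[OF smooth_on_fd[OF f, of a], of b] U
    unfolding smooth_on_def by (metis Ck_on.simps(1) continuous_on_eq_continuous_at)
  show "Re (fd (\<lambda>y. fd f y v) x w) = Re (fd (\<lambda>y. fd f y w) x v)"
    by (rule second_derivative_symmetric_real[OF U, of "\<lambda>y. Re (f y)" "\<lambda>y v. Re (fd f y v)"])
       (auto intro!: has_derivative_Re D1 D2 C isCont_Re)
  show "Im (fd (\<lambda>y. fd f y v) x w) = Im (fd (\<lambda>y. fd f y w) x v)"
    by (rule second_derivative_symmetric_real[OF U, of "\<lambda>y. Im (f y)" "\<lambda>y v. Im (fd f y v)"])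
       (auto intro!: has_derivative_Im D1 D2 C isCont_Im)
qed

section \<open>Reflections and Dunkl operators\<close>

lemma linear_root_reflection: "linear (root_reflection \<alpha>)"
  by (rule linearI)
     (auto simp: root_reflection_def algebra_simps inner_add_right add_divide_distrib)

lemma bounded_linear_root_reflection: "bounded_linear (root_reflection \<alpha>)"
  by (rule linear_conv_bounded_linear[THEN iffD1, OF linear_root_reflection])

lemma root_reflection_minus [simp]: "root_reflection (- \<alpha>) = root_reflection \<alpha>"
  by (auto simp: root_reflection_def)

lemma root_reflection_uminus [simp]: "root_reflection \<alpha> (- x) = - root_reflection \<alpha> x"
  by (simp add: root_reflection_def)

lemma root_reflection_self [simp]: "root_reflection \<alpha> \<alpha> = - \<alpha>"
  by (cases "\<alpha> = 0") (auto simp: root_reflection_def scaleR_2)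

lemma root_reflection_adjoint: "root_reflection \<alpha> x \<bullet> y = x \<bullet> root_reflection \<alpha> y"
  by (simp add: root_reflection_def algebra_simps inner_diff_left inner_diff_right inner_commute)

lemma root_reflection_involution [simp]: "root_reflection \<alpha> (root_reflection \<alpha> x) = x"
  by (cases "\<alpha> = 0")
     (auto simp: root_reflection_def inner_diff_right algebra_simps simp flip: scaleR_left.add)

lemma inner_root_reflection [simp]: "root_reflection \<alpha> x \<bullet> root_reflection \<alpha> y = x \<bullet> y"
  by (simp add: root_reflection_adjoint)

lemma norm_root_reflection [simp]: "norm (root_reflection \<alpha> x) = norm x"
  by (simp add: norm_eq_sqrt_inner)

lemma inner_self_root_reflection [simp]: "\<alpha> \<bullet> root_reflection \<alpha> x = - (\<alpha> \<bullet> x)"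
  by (simp flip: root_reflection_adjoint)

text \<open>A reflection is a linear isometry, so it carries the mirror of \<alpha> to the mirror of
  the reflected root. This yields the equivariance of the Dunkl operators in
  \<open>D_act\<close>.\<close>

lemma root_reflection_conj:
  "root_reflection (root_reflection \<beta> \<alpha>) (root_reflection \<beta> x)
    = root_reflection \<beta> (root_reflection \<alpha> x)"
proof -
  have "root_reflection \<beta> (x - c *\<^sub>R \<alpha>) = root_reflection \<beta> x - c *\<^sub>R root_reflection \<beta> \<alpha>" for c
    by (simp add: linear_diff[OF linear_root_reflection] linear_scale[OF linear_root_reflection])
  then show ?thesis by (simp add: root_reflection_def[of \<alpha>] root_reflection_def[of "root_reflection \<beta> \<alpha>"])
qed

section \<open>Roots, positive roots and the regular set\<close>

locale dunkl_setting =
  fixes R P :: "(real ^ 'n) set" and g :: "real ^ 'n \<Rightarrow> complex"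
  assumes root_system: "root_system R"
    and positive_roots: "positive_roots R P"
    and multiplicity: "multiplicity_function R g"
begin

abbreviation U :: "(real ^ 'n) set" where "U \<equiv> regular_set R"
abbreviation smooth :: "(real ^ 'n \<Rightarrow> complex) \<Rightarrow> bool" where "smooth \<equiv> smooth_on U"

lemma finite_R: "finite R" and zero_notin_R: "0 \<notin> R"
  and refl_R: "\<alpha> \<in> R \<Longrightarrow> root_reflection \<alpha> ` R = R"
  and line_R: "\<alpha> \<in> R \<Longrightarrow> R \<inter> range (\<lambda>c. c *\<^sub>R \<alpha>) = {\<alpha>, - \<alpha>}"
  using root_system by (auto simp: root_system_def)

lemma uminus_R [simp]: "\<alpha> \<in> R \<Longrightarrow> - \<alpha> \<in> R"
  using line_R[of \<alpha>] by blast

lemma refl_in_R [simp]: "\<beta> \<in> R \<Longrightarrow> \<alpha> \<in> R \<Longrightarrow> root_reflection \<beta> \<alpha> \<in> R"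
  using refl_R[of \<beta>] by blast

text \<open>The functional defining \<open>P\<close> is nonzero on roots, hence positive on exactly
  one of \<alpha> and -\<alpha>. The splitting reduces sums over \<open>P\<close> to sums over
  \<open>R\<close>, which reflections permute.\<close>

lemma R_split: "R = P \<union> uminus ` P" "P \<inter> uminus ` P = {}"
proof -
  obtain v where v: "\<And>\<alpha>. \<alpha> \<in> R \<Longrightarrow> v \<bullet> \<alpha> \<noteq> 0" "P = {\<alpha> \<in> R. v \<bullet> \<alpha> > 0}"
    using positive_roots by (auto simp: positive_roots_def)
  show "P \<inter> uminus ` P = {}" by (auto simp: v(2))
  have "\<alpha> \<in> P \<union> uminus ` P" if "\<alpha> \<in> R" for \<alpha>
  proof (cases "v \<bullet> \<alpha> > 0")
    case True then show ?thesis using v that by auto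
  next
    case False
    then have "- \<alpha> \<in> P" using v(1)[OF that] v(2) that by auto
    then show ?thesis by (metis UnI2 image_eqI minus_minus)
  qed
  moreover have "P \<subseteq> R" by (auto simp: v(2))
  ultimately show "R = P \<union> uminus ` P" by auto
qed

lemma P_R [simp]: "\<alpha> \<in> P \<Longrightarrow> \<alpha> \<in> R"
  using positive_roots by (auto simp: positive_roots_def)

lemma finite_P [simp]: "finite P"
  by (rule finite_subset[OF _ finite_R]) auto

lemma P_nonzero: "\<alpha> \<in> P \<Longrightarrow> \<alpha> \<noteq> 0"
  using zero_notin_R P_R by blast

lemma g_refl [simp]: "\<beta> \<in> R \<Longrightarrow> \<alpha> \<in> R \<Longrightarrow> g (root_reflection \<beta> \<alpha>) = g \<alpha>"
  using multiplicity generate.incl[of "root_reflection \<beta>" "root_reflection ` R" "BijGroup UNIV"]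
  unfolding multiplicity_function_def reflection_group_def by blast

lemma g_uminus [simp]: "\<alpha> \<in> R \<Longrightarrow> g (- \<alpha>) = g \<alpha>"
  using g_refl[of \<alpha> \<alpha>] by simp

lemma sum_R: "(\<And>\<alpha>. F (- \<alpha>) = F \<alpha>) \<Longrightarrow> sum F R = 2 * (\<Sum>\<alpha>\<in>P. F \<alpha> :: complex)"
  by (subst R_split(1), subst sum.union_disjoint) (auto simp: R_split(2) sum.reindex)

text \<open>A reflection permutes \<open>R\<close> but in general not \<open>P\<close>; for an even
  summand, the sum over \<open>P\<close> is half the sum over \<open>R\<close>.\<close>

lemma sum_P_refl:
  fixes F :: "real ^ 'n \<Rightarrow> complex"
  assumes "\<beta> \<in> R" "\<And>\<alpha>. F (- \<alpha>) = F \<alpha>"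
  shows "(\<Sum>\<alpha>\<in>P. F (root_reflection \<beta> \<alpha>)) = sum F P"
proof -
  have "2 * (\<Sum>\<alpha>\<in>P. F (root_reflection \<beta> \<alpha>)) = (\<Sum>\<alpha>\<in>R. F (root_reflection \<beta> \<alpha>))"
    by (rule sum_R[symmetric]) (simp add: assms)
  also have "\<dots> = sum F (root_reflection \<beta> ` R)"
    by (subst sum.reindex) (auto intro: inj_on_inverseI[where g = "root_reflection \<beta>"])
  also have "\<dots> = 2 * sum F P"
    using sum_R[of F] assms by (simp add: refl_R)
  finally show ?thesis by simp
qed

lemma open_U: "open U"
proof -
  have "U = (- {0}) \<inter> (\<Inter>\<alpha>\<in>R. {x. \<alpha> \<bullet> x \<noteq> 0})" by (auto simp: regular_set_def)
  also have "open \<dots>"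
    using finite_R by (intro open_Int open_INT ballI open_Collect_neq continuous_intros) auto
  finally show ?thesis .
qed

lemma U_nonzero: "x \<in> U \<Longrightarrow> x \<noteq> 0"
  and U_inner: "x \<in> U \<Longrightarrow> \<alpha> \<in> R \<Longrightarrow> \<alpha> \<bullet> x \<noteq> 0"
  and zero_notin_U: "0 \<notin> U"
  by (auto simp: regular_set_def)

lemma refl_U [simp]: "\<alpha> \<in> R \<Longrightarrow> x \<in> U \<Longrightarrow> root_reflection \<alpha> x \<in> U"
proof -
  assume *: "\<alpha> \<in> R" "x \<in> U"
  have "root_reflection \<alpha> x \<noteq> 0"
    using norm_root_reflection[of \<alpha> x] U_nonzero[OF *(2)] by (metis norm_eq_zero)
  moreover have "\<beta> \<bullet> root_reflection \<alpha> x \<noteq> 0" if "\<beta> \<in> R" for \<beta>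
    using U_inner[OF *(2) refl_in_R[OF *(1) that]] by (simp add: root_reflection_adjoint)
  ultimately show ?thesis by (simp add: regular_set_def)
qed

text \<open>Equal reflections of a regular point force nonzero multiples of \<alpha> and \<beta> to
  coincide, so the roots are proportional, and two proportional positive roots are equal. Hence
  products of two different positive reflections move every regular point.\<close>

lemma refl_refl_fixed:
  assumes "\<alpha> \<in> P" "\<beta> \<in> P" "x \<in> U" "root_reflection \<beta> (root_reflection \<alpha> x) = x"
  shows "\<alpha> = \<beta>"
proof -
  have "root_reflection \<alpha> x = root_reflection \<beta> x"
    using assms(4) by (metis root_reflection_involution)
  then have eq: "(2 * (\<alpha> \<bullet> x) / (\<alpha> \<bullet> \<alpha>)) *\<^sub>R \<alpha>
    = (2 * (\<beta> \<bullet> x) / (\<beta> \<bullet> \<beta>)) *\<^sub>R \<beta>" (is "?a *\<^sub>R \<alpha> = ?b *\<^sub>R \<beta>")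
    by (simp add: root_reflection_def)
  have "?b \<noteq> 0" using U_inner assms P_nonzero by auto
  then have "\<beta> = (1 / ?b) *\<^sub>R (?b *\<^sub>R \<beta>)" by (subst scaleR_scaleR) simp
  also have "\<dots> = (?a / ?b) *\<^sub>R \<alpha>"
    by (subst eq[symmetric], subst scaleR_scaleR) (simp add: mult.commute)
  finally have "\<beta> = (?a / ?b) *\<^sub>R \<alpha>" .
  then have "\<beta> \<in> R \<inter> range (\<lambda>c. c *\<^sub>R \<alpha>)" using assms(2) by auto
  then have "\<beta> \<in> {\<alpha>, - \<alpha>}" using line_R[of \<alpha>] assms(1) by simp
  moreover have "\<beta> \<noteq> - \<alpha>" using R_split(2) assms(1,2) by blast
  ultimately show ?thesis by simp
qed

section \<open>Dunkl operators and their commutators with reflections and linear functions\<close>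

definition act :: "real ^ 'n \<Rightarrow> (real ^ 'n \<Rightarrow> complex) \<Rightarrow> real ^ 'n \<Rightarrow> complex" where
  "act \<alpha> f x = f (root_reflection \<alpha> x)"

text \<open>The Dunkl operator in an arbitrary direction \<open>v\<close>; the coordinate operators are \<open>D (axis i 1)\<close>.\<close>
definition D :: "real ^ 'n \<Rightarrow> (real ^ 'n \<Rightarrow> complex) \<Rightarrow> real ^ 'n \<Rightarrow> complex" where
  "D v f x = fd f x v - (\<Sum>\<alpha>\<in>P. g \<alpha> * of_real (\<alpha> \<bullet> v) / of_real (\<alpha> \<bullet> x) * act \<alpha> f x)"

lemma smooth_const [simp]: "smooth (\<lambda>x. c)"
  and smooth_add [simp]: "smooth f \<Longrightarrow> smooth h \<Longrightarrow> smooth (\<lambda>x. f x + h x)"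
  and smooth_mult [simp]: "smooth f \<Longrightarrow> smooth h \<Longrightarrow> smooth (\<lambda>x. f x * h x)"
  and smooth_inner [simp]: "smooth (\<lambda>x. of_real (u \<bullet> x))"
  by (auto simp: smooth_on_def intro: Ck_on_const Ck_on_add Ck_on_mult Ck_on_inner open_U)

lemma smooth_coord [simp]: "smooth (\<lambda>x. of_real (x $ i))"
  using smooth_inner[of "axis i 1"] by (simp add: inner_axis_axis inner_axis')

lemma smooth_radius [simp]: "smooth (\<lambda>x. 1 / of_real (norm x))"
  using Ck_on_inverse_norm[OF open_U zero_notin_U] by (simp add: smooth_on_def)

lemma smooth_uminus [simp]: "smooth f \<Longrightarrow> smooth (\<lambda>x. - f x)"
  using smooth_mult[of "\<lambda>x. -1" f] by simp

lemma smooth_diff [simp]: "smooth f \<Longrightarrow> smooth h \<Longrightarrow> smooth (\<lambda>x. f x - h x)"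
  using smooth_add[of f "\<lambda>x. - h x"] by simp

lemma smooth_sum [simp]: "(\<And>a. a \<in> A \<Longrightarrow> smooth (f a)) \<Longrightarrow> smooth (\<lambda>x. \<Sum>a\<in>A. f a x)"
  by (rule smooth_on_sum[OF open_U])

lemma smooth_act [simp]: "\<alpha> \<in> R \<Longrightarrow> smooth f \<Longrightarrow> smooth (act \<alpha> f)"
  unfolding smooth_on_def act_def[abs_def]
  by (blast intro: Ck_on_compose_linear open_U bounded_linear_root_reflection refl_U)

lemma smooth_divide_const [simp]: "smooth f \<Longrightarrow> smooth (\<lambda>x. f x / c)"
  using smooth_mult[of f "\<lambda>x. inverse c"] by (simp add: divide_inverse)

lemma smooth_inverse: "smooth f \<Longrightarrow> (\<And>x. x \<in> U \<Longrightarrow> f x \<noteq> 0) \<Longrightarrow> smooth (\<lambda>x. inverse (f x))"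
  unfolding smooth_on_def using Ck_on_inverse open_U by blast

lemma smooth_divide_root [simp]:
  assumes "\<alpha> \<in> R" "smooth f" shows "smooth (\<lambda>x. f x / of_real (\<alpha> \<bullet> x))"
proof -
  have "smooth (\<lambda>x. inverse (of_real (\<alpha> \<bullet> x)))"
    by (rule smooth_inverse) (use U_inner assms in auto)
  from smooth_mult[OF assms(2) this] show ?thesis by (simp add: divide_inverse)
qed

lemma smooth_D [simp]:
  assumes "smooth f" shows "smooth (D v f)"
proof -
  have "D v f = (\<lambda>x. fd f x v - (\<Sum>\<alpha>\<in>P. g \<alpha> * of_real (\<alpha> \<bullet> v) / of_real (\<alpha> \<bullet> x) * act \<alpha> f x))"
    by (simp add: D_def fun_eq_iff)
  moreover have "smooth \<dots>" using assms smooth_on_fd[OF assms] by simp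
  ultimately show ?thesis by simp
qed

lemma smooth_deriv: "smooth f \<Longrightarrow> x \<in> U \<Longrightarrow> (f has_derivative fd f x) (at x)"
  by (rule smooth_on_has_derivative)

lemma D_cong:
  assumes "x \<in> U" "\<And>y. y \<in> U \<Longrightarrow> f y = h y"
  shows "D v f x = D v h x"
proof -
  have "act \<alpha> f x = act \<alpha> h x" if "\<alpha> \<in> P" for \<alpha>
    using assms that by (simp add: act_def)
  then show ?thesis
    unfolding D_def by (intro arg_cong2[of _ _ _ _ "(-)"] fd_cong[OF open_U assms] sum.cong) simp_all
qed

text \<open>Lets the simplifier assume \<open>y \<in> U\<close> below \<open>D\<close>, so that
  identities valid only on the regular set rewrite the argument of an outer Dunkl operator.\<close>

lemma D_simp_cong [cong]:
  "v = w \<Longrightarrow> x = z \<Longrightarrow> z \<in> U \<Longrightarrow> (\<And>y. y \<in> U =simp=> f y = h y) \<Longrightarrow> D v f x = D w h z"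
  unfolding simp_implies_def by (metis D_cong)

lemma D_add:
  assumes "smooth f" "smooth h" "x \<in> U"
  shows "D v (\<lambda>y. f y + h y) x = D v f x + D v h x"
proof -
  have "fd (\<lambda>y. f y + h y) x v = fd f x v + fd h x v"
    by (rule fd_has_derivative, rule has_derivative_add) (auto intro: smooth_deriv assms)
  then show ?thesis
    by (simp add: D_def act_def distrib_left sum.distrib)
qed

text \<open>An invariant factor passes through the reflection terms, so only the Leibniz term of the
  derivative remains. Constants and powers of the inverse radius are the cases used.\<close>

lemma D_invariant_mult:
  assumes "smooth f" "smooth \<rho>" "x \<in> U" "\<And>\<alpha>. \<alpha> \<in> P \<Longrightarrow> \<rho> (root_reflection \<alpha> x) = \<rho> x"
  shows "D v (\<lambda>y. \<rho> y * f y) x = \<rho> x * D v f x + fd \<rho> x v * f x"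
proof -
  have "fd (\<lambda>y. \<rho> y * f y) x v = \<rho> x * fd f x v + fd \<rho> x v * f x"
    by (rule fd_has_derivative, rule has_derivative_mult) (auto intro: smooth_deriv assms)
  moreover have "(\<Sum>\<alpha>\<in>P. g \<alpha> * of_real (\<alpha> \<bullet> v) / of_real (\<alpha> \<bullet> x) * act \<alpha> (\<lambda>y. \<rho> y * f y) x)
    = \<rho> x * (\<Sum>\<alpha>\<in>P. g \<alpha> * of_real (\<alpha> \<bullet> v) / of_real (\<alpha> \<bullet> x) * act \<alpha> f x)"
    unfolding sum_distrib_left by (rule sum.cong) (simp_all add: act_def assms)
  ultimately show ?thesis
    unfolding D_def by (simp add: algebra_simps)
qed

lemma D_cmult: "smooth f \<Longrightarrow> x \<in> U \<Longrightarrow> D v (\<lambda>y. c * f y) x = c * D v f x"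
  using D_invariant_mult[of f "\<lambda>x. c"] by simp

lemma D_zero [simp]: "D v (\<lambda>y. 0) x = 0"
  by (simp add: D_def act_def cong del: D_simp_cong)

lemma D_uminus: "smooth f \<Longrightarrow> x \<in> U \<Longrightarrow> D v (\<lambda>y. - f y) x = - D v f x"
  using D_cmult[of f x v "-1"] by simp

lemma D_diff: "smooth f \<Longrightarrow> smooth h \<Longrightarrow> x \<in> U \<Longrightarrow> D v (\<lambda>y. f y - h y) x = D v f x - D v h x"
  using D_add[of f "\<lambda>y. - h y" x v] D_uminus[of h x v] by simp

lemma D_sum:
  assumes "finite A" "\<And>a. a \<in> A \<Longrightarrow> smooth (f a)" "x \<in> U"
  shows "D v (\<lambda>y. \<Sum>a\<in>A. f a y) x = (\<Sum>a\<in>A. D v (f a) x)"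
  using assms by (induction A) (simp_all add: D_add)

lemma D_linear: "smooth f \<Longrightarrow> x \<in> U \<Longrightarrow> linear (\<lambda>v. D v f x)"
  unfolding D_def
  by (intro linear_compose_sub linear_compose_sum ballI has_derivative_linear[OF smooth_deriv])
     (auto intro!: linearI simp: inner_add_right distrib_left distrib_right add_divide_distrib
       scaleR_conv_of_real[where 'a = complex])

lemma D_scaleR: "smooth f \<Longrightarrow> x \<in> U \<Longrightarrow> D (c *\<^sub>R v) f x = of_real c * D v f x"
  using linear_scale[OF D_linear] by (simp add: scaleR_conv_of_real cong del: D_simp_cong)

lemma D_basis_sum:
  assumes "smooth f" "x \<in> U"
  shows "(\<Sum>i\<in>UNIV. of_real (u $ i) * D (axis i 1) f x) = D u f x"
proof -
  have "D u f x = D (\<Sum>i\<in>UNIV. (u $ i) *\<^sub>R axis i 1) f x"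
    using basis_expansion[of u] by (simp only: scalar_mult_eq_scaleR)
  also have "\<dots> = (\<Sum>i\<in>UNIV. D ((u $ i) *\<^sub>R axis i 1) f x)"
    by (rule linear_sum[OF D_linear[OF assms]])
  finally show ?thesis by (simp add: D_scaleR assms)
qed

text \<open>The chain rule handles the derivative. In the reflection terms the roots are replaced by
  their images under \<open>root_reflection \<beta>\<close>: \<open>root_reflection_conj\<close>
  moves the reflection past \<beta>, \<open>g\<close> is invariant, and evenness in \<alpha> permits
  \<open>sum_P_refl\<close>.\<close>

lemma D_act:
  assumes "smooth f" "x \<in> U" "\<beta> \<in> R"
  shows "D v (act \<beta> f) x = D (root_reflection \<beta> v) f (root_reflection \<beta> x)"
proof -
  let ?s = "root_reflection \<beta>"
  have "fd (act \<beta> f) x v = fd f (?s x) (?s v)"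
    unfolding act_def[abs_def]
    by (rule fd_has_derivative,
        rule has_derivative_compose[OF bounded_linear_imp_has_derivative[OF bounded_linear_root_reflection]])
       (auto intro: smooth_deriv refl_U assms)
  moreover have "(\<Sum>\<alpha>\<in>P. g \<alpha> * of_real (\<alpha> \<bullet> v) / of_real (\<alpha> \<bullet> x) * f (?s (root_reflection \<alpha> x)))
    = (\<Sum>\<alpha>\<in>P. g \<alpha> * of_real (\<alpha> \<bullet> ?s v) / of_real (\<alpha> \<bullet> ?s x) * f (root_reflection \<alpha> (?s x)))"
    (is "?L = sum ?G P")
  proof -
    \<comment> \<open>The cutoff to \<open>R\<close> makes \<open>F\<close> even on all vectors, as
      \<open>sum_P_refl\<close> requires; evenness of \<open>g\<close> is available on roots
      only.\<close>
    define F where "F \<alpha> = (if \<alpha> \<in> R then ?G \<alpha> else 0)" for \<alpha>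
    have "F (- \<alpha>) = F \<alpha>" for \<alpha>
    proof -
      have "- \<alpha> \<in> R \<longleftrightarrow> \<alpha> \<in> R" using uminus_R[of \<alpha>] uminus_R[of "- \<alpha>"] by auto
      then show ?thesis by (simp add: F_def)
    qed
    then have "(\<Sum>\<alpha>\<in>P. F (?s \<alpha>)) = sum F P" by (rule sum_P_refl[OF assms(3)])
    moreover have "(\<Sum>\<alpha>\<in>P. F (?s \<alpha>)) = ?L"
      by (rule sum.cong) (simp_all add: F_def assms(3) root_reflection_conj)
    moreover have "sum F P = sum ?G P" by (rule sum.cong) (simp_all add: F_def)
    ultimately show ?thesis by simp
  qed
  ultimately show ?thesis by (simp add: D_def act_def)
qed

lemma D_act_commutator:
  assumes "smooth f" "x \<in> U" "\<alpha> \<in> R"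
  shows "D v (act \<alpha> f) x = act \<alpha> (D v f) x - of_real (2 * (\<alpha> \<bullet> v) / (\<alpha> \<bullet> \<alpha>)) * act \<alpha> (D \<alpha> f) x"
proof -
  have "D (root_reflection \<alpha> v) f y = D v f y - of_real (2 * (\<alpha> \<bullet> v) / (\<alpha> \<bullet> \<alpha>)) * D \<alpha> f y"
    if "y \<in> U" for y
    unfolding root_reflection_def linear_diff[OF D_linear[OF assms(1) that]] D_scaleR[OF assms(1) that] ..
  then show ?thesis using assms by (simp add: D_act) (simp add: act_def)
qed

text \<open>\<open>T v u\<close> is the commutator of \<open>D v\<close> with multiplication by the linear function \<open>u \<bullet> x\<close>.\<close>
definition T :: "real ^ 'n \<Rightarrow> real ^ 'n \<Rightarrow> (real ^ 'n \<Rightarrow> complex) \<Rightarrow> real ^ 'n \<Rightarrow> complex" where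
  "T v u f x = of_real (v \<bullet> u) * f x
     + (\<Sum>\<alpha>\<in>P. g \<alpha> * of_real (2 * (\<alpha> \<bullet> v) * (\<alpha> \<bullet> u) / (\<alpha> \<bullet> \<alpha>)) * act \<alpha> f x)"

lemma smooth_T [simp]:
  assumes "smooth f" shows "smooth (T v u f)"
proof -
  have "T v u f = (\<lambda>x. of_real (v \<bullet> u) * f x
     + (\<Sum>\<alpha>\<in>P. g \<alpha> * of_real (2 * (\<alpha> \<bullet> v) * (\<alpha> \<bullet> u) / (\<alpha> \<bullet> \<alpha>)) * act \<alpha> f x))"
    by (simp add: T_def fun_eq_iff)
  moreover have "smooth \<dots>" using assms by simp
  ultimately show ?thesis by simp
qed

text \<open>Reflecting the linear factor changes it by a multiple of
  \<open>\<alpha> \<bullet> x\<close>, which cancels the singular denominator. The commutator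
  \<open>T v u\<close> therefore has constant coefficients.\<close>

lemma D_inner_mult:
  assumes "smooth f" "x \<in> U"
  shows "D v (\<lambda>y. of_real (u \<bullet> y) * f y) x = of_real (u \<bullet> x) * D v f x + T v u f x"
proof -
  have "fd (\<lambda>y. of_real (u \<bullet> y) * f y) x v = of_real (u \<bullet> x) * fd f x v + of_real (u \<bullet> v) * f x"
    by (rule fd_has_derivative)
       (auto intro!: derivative_eq_intros smooth_deriv assms)
  moreover have "g \<alpha> * of_real (\<alpha> \<bullet> v) / of_real (\<alpha> \<bullet> x) * (of_real (u \<bullet> root_reflection \<alpha> x) * h)
    = of_real (u \<bullet> x) * (g \<alpha> * of_real (\<alpha> \<bullet> v) / of_real (\<alpha> \<bullet> x) * h)
      - g \<alpha> * of_real (2 * (\<alpha> \<bullet> v) * (\<alpha> \<bullet> u) / (\<alpha> \<bullet> \<alpha>)) * h" if "\<alpha> \<in> P" for \<alpha> h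
  proof -
    have nz: "\<alpha> \<bullet> x \<noteq> 0" using U_inner[OF assms(2)] that by simp
    have eq: "of_real (u \<bullet> root_reflection \<alpha> x)
      = (of_real (u \<bullet> x) - of_real (2 * (\<alpha> \<bullet> x) / (\<alpha> \<bullet> \<alpha>)) * of_real (\<alpha> \<bullet> u) :: complex)"
      by (simp add: root_reflection_def inner_diff_right inner_commute)
    show ?thesis unfolding eq using nz by (simp add: field_simps)
  qed
  then have "(\<Sum>\<alpha>\<in>P. g \<alpha> * of_real (\<alpha> \<bullet> v) / of_real (\<alpha> \<bullet> x) * act \<alpha> (\<lambda>y. of_real (u \<bullet> y) * f y) x)
    = of_real (u \<bullet> x) * (\<Sum>\<alpha>\<in>P. g \<alpha> * of_real (\<alpha> \<bullet> v) / of_real (\<alpha> \<bullet> x) * act \<alpha> f x)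
      - (\<Sum>\<alpha>\<in>P. g \<alpha> * of_real (2 * (\<alpha> \<bullet> v) * (\<alpha> \<bullet> u) / (\<alpha> \<bullet> \<alpha>)) * act \<alpha> f x)"
    unfolding sum_distrib_left sum_subtractf[symmetric] act_def by (intro sum.cong refl)
  ultimately show ?thesis
    unfolding D_def T_def by (simp add: right_diff_distrib inner_commute del: of_real_mult of_real_divide)
qed

section \<open>Commutativity of the Dunkl operators\<close>

lemma fd_D:
  assumes "smooth f" "x \<in> U"
  shows "fd (D w f) x v = fd (\<lambda>y. fd f y w) x v
    - (\<Sum>\<alpha>\<in>P. g \<alpha> * of_real (\<alpha> \<bullet> w) *
        (fd f (root_reflection \<alpha> x) (root_reflection \<alpha> v) / of_real (\<alpha> \<bullet> x)
         - of_real (\<alpha> \<bullet> v) / of_real (\<alpha> \<bullet> x) ^ 2 * act \<alpha> f x))"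
proof -
  have 1: "((\<lambda>y. fd f y w) has_derivative fd (\<lambda>y. fd f y w) x) (at x)"
    by (intro smooth_deriv smooth_on_fd assms)
  have 2: "((\<lambda>y. g \<alpha> * of_real (\<alpha> \<bullet> w) / of_real (\<alpha> \<bullet> y) * act \<alpha> f y) has_derivative
    (\<lambda>v. g \<alpha> * of_real (\<alpha> \<bullet> w) *
        (fd f (root_reflection \<alpha> x) (root_reflection \<alpha> v) / of_real (\<alpha> \<bullet> x)
         - of_real (\<alpha> \<bullet> v) / of_real (\<alpha> \<bullet> x) ^ 2 * act \<alpha> f x))) (at x)" if "\<alpha> \<in> P" for \<alpha>
  proof -
    have nz: "\<alpha> \<bullet> x \<noteq> 0" using U_inner[OF assms(2)] that by simp
    have "(act \<alpha> f has_derivative (\<lambda>v. fd f (root_reflection \<alpha> x) (root_reflection \<alpha> v))) (at x)"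
      unfolding act_def[abs_def]
      by (rule has_derivative_compose[OF bounded_linear_imp_has_derivative[OF bounded_linear_root_reflection]])
         (intro smooth_deriv assms refl_U P_R that)
    then show ?thesis
      using nz by (auto intro!: derivative_eq_intros simp: fun_eq_iff field_simps power2_eq_square)
  qed
  have "((\<lambda>y. fd f y w - (\<Sum>\<alpha>\<in>P. g \<alpha> * of_real (\<alpha> \<bullet> w) / of_real (\<alpha> \<bullet> y) * act \<alpha> f y)) has_derivative
    (\<lambda>v. fd (\<lambda>y. fd f y w) x v
    - (\<Sum>\<alpha>\<in>P. g \<alpha> * of_real (\<alpha> \<bullet> w) *
        (fd f (root_reflection \<alpha> x) (root_reflection \<alpha> v) / of_real (\<alpha> \<bullet> x)
         - of_real (\<alpha> \<bullet> v) / of_real (\<alpha> \<bullet> x) ^ 2 * act \<alpha> f x)))) (at x)"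
    by (intro has_derivative_diff has_derivative_sum 1 2)
  then have "(D w f has_derivative
    (\<lambda>v. fd (\<lambda>y. fd f y w) x v
    - (\<Sum>\<alpha>\<in>P. g \<alpha> * of_real (\<alpha> \<bullet> w) *
        (fd f (root_reflection \<alpha> x) (root_reflection \<alpha> v) / of_real (\<alpha> \<bullet> x)
         - of_real (\<alpha> \<bullet> v) / of_real (\<alpha> \<bullet> x) ^ 2 * act \<alpha> f x)))) (at x)"
    by (simp add: D_def[abs_def])
  then show ?thesis by (rule fd_has_derivative)
qed

text \<open>The grouping isolates what survives antisymmetrization: the second derivative and the
  single sum over \<alpha> are symmetric in \<open>v\<close> and \<open>w\<close>, and only the
  double sum is not.\<close>

lemma D_D:
  assumes "smooth f" "x \<in> U"
  shows "D v (D w f) x = fd (\<lambda>y. fd f y w) x v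
    - (\<Sum>\<alpha>\<in>P. g \<alpha> / of_real (\<alpha> \<bullet> x) *
        (of_real (\<alpha> \<bullet> w) * fd f (root_reflection \<alpha> x) v + of_real (\<alpha> \<bullet> v) * fd f (root_reflection \<alpha> x) w
         - of_real (2 * ((\<alpha> \<bullet> v) * (\<alpha> \<bullet> w)) / (\<alpha> \<bullet> \<alpha>)) * fd f (root_reflection \<alpha> x) \<alpha>
         - of_real ((\<alpha> \<bullet> v) * (\<alpha> \<bullet> w)) / of_real (\<alpha> \<bullet> x) * act \<alpha> f x))
    + (\<Sum>\<alpha>\<in>P. \<Sum>\<beta>\<in>P. g \<alpha> * of_real (\<alpha> \<bullet> v) / of_real (\<alpha> \<bullet> x) *
        (g \<beta> * of_real (\<beta> \<bullet> w) / of_real (\<beta> \<bullet> root_reflection \<alpha> x)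
         * f (root_reflection \<beta> (root_reflection \<alpha> x))))"
proof -
  have lin: "fd f (root_reflection \<alpha> x) (root_reflection \<alpha> v)
      = fd f (root_reflection \<alpha> x) v
      - of_real (2 * (\<alpha> \<bullet> v) / (\<alpha> \<bullet> \<alpha>)) * fd f (root_reflection \<alpha> x) \<alpha>"
    if "\<alpha> \<in> P" for \<alpha>
  proof -
    have "linear (fd f (root_reflection \<alpha> x))"
      using has_derivative_linear[OF smooth_deriv] assms refl_U that P_R by blast
    then show ?thesis
      by (simp add: root_reflection_def[of \<alpha> v] linear_diff linear_scale scaleR_conv_of_real[where 'a = complex])
  qed
  have act_D: "act \<alpha> (D w f) x = fd f (root_reflection \<alpha> x) w
    - (\<Sum>\<beta>\<in>P. g \<beta> * of_real (\<beta> \<bullet> w) / of_real (\<beta> \<bullet> root_reflection \<alpha> x)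
         * f (root_reflection \<beta> (root_reflection \<alpha> x)))" for \<alpha>
    by (simp add: act_def D_def)
  \<comment> \<open>For one root, this merges the derivative of the reflection term of
    \<open>D w f\<close> with the reflection term of the outer operator.\<close>
  have summand: "g \<alpha> * of_real (\<alpha> \<bullet> w) *
        (fd f (root_reflection \<alpha> x) (root_reflection \<alpha> v) / of_real (\<alpha> \<bullet> x)
         - of_real (\<alpha> \<bullet> v) / of_real (\<alpha> \<bullet> x) ^ 2 * act \<alpha> f x)
      + g \<alpha> * of_real (\<alpha> \<bullet> v) / of_real (\<alpha> \<bullet> x) * act \<alpha> (D w f) x
    = g \<alpha> / of_real (\<alpha> \<bullet> x) *
        (of_real (\<alpha> \<bullet> w) * fd f (root_reflection \<alpha> x) v + of_real (\<alpha> \<bullet> v) * fd f (root_reflection \<alpha> x) w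
         - of_real (2 * ((\<alpha> \<bullet> v) * (\<alpha> \<bullet> w)) / (\<alpha> \<bullet> \<alpha>)) * fd f (root_reflection \<alpha> x) \<alpha>
         - of_real ((\<alpha> \<bullet> v) * (\<alpha> \<bullet> w)) / of_real (\<alpha> \<bullet> x) * act \<alpha> f x)
      - g \<alpha> * of_real (\<alpha> \<bullet> v) / of_real (\<alpha> \<bullet> x)
      * (\<Sum>\<beta>\<in>P. g \<beta> * of_real (\<beta> \<bullet> w) / of_real (\<beta> \<bullet> root_reflection \<alpha> x)
         * f (root_reflection \<beta> (root_reflection \<alpha> x)))" if "\<alpha> \<in> P" for \<alpha>
    unfolding lin[OF that] act_D
    by (simp add: divide_inverse algebra_simps power2_eq_square)
  show ?thesis
    unfolding D_def[of v] fd_D[OF assms] diff_diff_eq sum.distrib[symmetric]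
    by (subst sum.cong[OF refl summand], assumption)
       (simp add: sum_subtractf sum_distrib_left diff_diff_eq)
qed

lemma D_commutator_expansion:
  assumes "smooth f" "x \<in> U"
  shows "D v (D w f) x - D w (D v f) x = (\<Sum>\<alpha>\<in>P. \<Sum>\<beta>\<in>P.
    g \<alpha> * g \<beta> * of_real ((\<alpha> \<bullet> v) * (\<beta> \<bullet> w) - (\<alpha> \<bullet> w) * (\<beta> \<bullet> v)) / (of_real (\<alpha> \<bullet> x) * of_real (\<beta> \<bullet> root_reflection \<alpha> x))
    * f (root_reflection \<beta> (root_reflection \<alpha> x)))"
proof -
  \<comment> \<open>\<open>Q\<close> is the part of \<open>D_D\<close> that is symmetric in
    \<open>v\<close> and \<open>w\<close> and drops out of the commutator.\<close>
  define Q where "Q v w = fd (\<lambda>y. fd f y w) x v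
    - (\<Sum>\<alpha>\<in>P. g \<alpha> / of_real (\<alpha> \<bullet> x) *
        (of_real (\<alpha> \<bullet> w) * fd f (root_reflection \<alpha> x) v + of_real (\<alpha> \<bullet> v) * fd f (root_reflection \<alpha> x) w
         - of_real (2 * ((\<alpha> \<bullet> v) * (\<alpha> \<bullet> w)) / (\<alpha> \<bullet> \<alpha>)) * fd f (root_reflection \<alpha> x) \<alpha>
         - of_real ((\<alpha> \<bullet> v) * (\<alpha> \<bullet> w)) / of_real (\<alpha> \<bullet> x) * act \<alpha> f x))" for v w
  have "Q v w = Q w v"
    unfolding Q_def second_derivative_symmetric[OF open_U assms(2,1), of w v]
    by (simp only: mult.commute[of "_ \<bullet> v" "_ \<bullet> w"] add.commute[of "of_real (_ \<bullet> w) * _" "of_real (_ \<bullet> v) * _"])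
  then show ?thesis
    unfolding D_D[OF assms] Q_def[symmetric]
    by (simp add: sum_subtractf[symmetric])
       (intro sum.cong refl, simp add: divide_inverse algebra_simps)
qed

text \<open>Each reflection in \<open>T\<close> contributes the correction from
  \<open>D_act_commutator\<close>. The total correction depends on \<open>v\<close> and
  \<open>w\<close> only through \<open>(\<alpha> \<bullet> v) * (\<alpha> \<bullet> w)\<close>,
  hence is symmetric in them.\<close>

lemma D_T_commutator:
  assumes "smooth f" "x \<in> U"
  shows "D v (T w u f) x = T w u (D v f) x
    - (\<Sum>\<alpha>\<in>P. g \<alpha> * of_real (4 * ((\<alpha> \<bullet> v) * (\<alpha> \<bullet> w)) * (\<alpha> \<bullet> u) / (\<alpha> \<bullet> \<alpha>)\<^sup>2) * act \<alpha> (D \<alpha> f) x)"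
proof -
  have "D v (T w u f) x = D v (\<lambda>y. of_real (w \<bullet> u) * f y
     + (\<Sum>\<alpha>\<in>P. g \<alpha> * of_real (2 * (\<alpha> \<bullet> w) * (\<alpha> \<bullet> u) / (\<alpha> \<bullet> \<alpha>)) * act \<alpha> f y)) x"
    by (rule D_cong[OF assms(2)]) (simp add: T_def)
  also have "\<dots> = of_real (w \<bullet> u) * D v f x
     + (\<Sum>\<alpha>\<in>P. g \<alpha> * of_real (2 * (\<alpha> \<bullet> w) * (\<alpha> \<bullet> u) / (\<alpha> \<bullet> \<alpha>)) * D v (act \<alpha> f) x)"
    using assms by (simp add: D_add D_cmult D_sum del: of_real_mult of_real_divide)
  also have "(\<Sum>\<alpha>\<in>P. g \<alpha> * of_real (2 * (\<alpha> \<bullet> w) * (\<alpha> \<bullet> u) / (\<alpha> \<bullet> \<alpha>)) * D v (act \<alpha> f) x)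
    = (\<Sum>\<alpha>\<in>P. g \<alpha> * of_real (2 * (\<alpha> \<bullet> w) * (\<alpha> \<bullet> u) / (\<alpha> \<bullet> \<alpha>)) * act \<alpha> (D v f) x)
      - (\<Sum>\<alpha>\<in>P. g \<alpha> * of_real (4 * ((\<alpha> \<bullet> v) * (\<alpha> \<bullet> w)) * (\<alpha> \<bullet> u) / (\<alpha> \<bullet> \<alpha>)\<^sup>2) * act \<alpha> (D \<alpha> f) x)"
    unfolding sum_subtractf[symmetric]
    by (intro sum.cong refl, subst D_act_commutator[OF assms], simp)
       (simp add: divide_inverse algebra_simps power2_eq_square)
  finally show ?thesis by (simp add: T_def)
qed

section \<open>Polynomial factors and the vanishing of the commutator\<close>

text \<open>Besides the expected product, moving the linear factor out leaves
  \<open>T v u (D w f) + D v (T w u f)\<close>. By \<open>D_T_commutator\<close> this is symmetric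
  in \<open>v\<close> and \<open>w\<close>, so it cancels.\<close>

lemma D_commutator_inner_mult:
  assumes "smooth f" "x \<in> U"
  shows "D v (D w (\<lambda>y. of_real (u \<bullet> y) * f y)) x - D w (D v (\<lambda>y. of_real (u \<bullet> y) * f y)) x
    = of_real (u \<bullet> x) * (D v (D w f) x - D w (D v f) x)"
proof -
  have *: "D v (D w (\<lambda>y. of_real (u \<bullet> y) * f y)) x
    = of_real (u \<bullet> x) * D v (D w f) x + T v u (D w f) x + D v (T w u f) x" for v w
  proof -
    have "D v (D w (\<lambda>y. of_real (u \<bullet> y) * f y)) x
      = D v (\<lambda>y. of_real (u \<bullet> y) * D w f y + T w u f y) x"
      by (rule D_cong[OF assms(2)]) (rule D_inner_mult[OF assms(1)])
    also have "\<dots> = of_real (u \<bullet> x) * D v (D w f) x + T v u (D w f) x + D v (T w u f) x"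
      using assms by (simp add: D_add D_inner_mult)
    finally show ?thesis .
  qed
  show ?thesis
    unfolding * D_T_commutator[OF assms] by (simp add: algebra_simps)
qed

text \<open>Induction on the number of affine factors: the linear part is
  \<open>D_commutator_inner_mult\<close>, the constant part is linearity.\<close>

lemma D_commutator_prod_mult:
  assumes "smooth f" "x \<in> U" "finite A"
  shows "D v (D w (\<lambda>y. (\<Prod>p\<in>A. of_real (u p \<bullet> y + c p)) * f y)) x
    - D w (D v (\<lambda>y. (\<Prod>p\<in>A. of_real (u p \<bullet> y + c p)) * f y)) x
    = (\<Prod>p\<in>A. of_real (u p \<bullet> x + c p)) * (D v (D w f) x - D w (D v f) x)"
  using assms(3)
proof induction
  case (insert a A)
  define h where "h = (\<lambda>y. (\<Prod>p\<in>A. of_real (u p \<bullet> y + c p)) * f y)"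
  have "smooth (\<lambda>y. \<Prod>p\<in>A. of_real (u p \<bullet> y + c p))"
    using insert(1) by (induction A) auto
  then have h: "smooth h" unfolding h_def using assms by simp
  have "D v (D w (\<lambda>y. of_real (u a \<bullet> y) * h y + of_real (c a) * h y)) x
    = D v (D w (\<lambda>y. of_real (u a \<bullet> y) * h y)) x + of_real (c a) * D v (D w h) x" for v w
    using h assms by (simp add: D_add D_cmult)
  then have eq1: "D v (D w (\<lambda>y. of_real (u a \<bullet> y) * h y + of_real (c a) * h y)) x
    - D w (D v (\<lambda>y. of_real (u a \<bullet> y) * h y + of_real (c a) * h y)) x
    = of_real (u a \<bullet> x + c a) * (D v (D w h) x - D w (D v h) x)"
    using D_commutator_inner_mult[OF h assms(2), of v w "u a"] by (simp add: algebra_simps)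
  have eq2: "(\<lambda>y. (\<Prod>p\<in>insert a A. of_real (u p \<bullet> y + c p)) * f y)
    = (\<lambda>y. of_real (u a \<bullet> y) * h y + of_real (c a) * h y)"
    using insert(1,2) by (simp add: h_def algebra_simps)
  show ?case
    unfolding eq2 unfolding eq1 prod.insert[OF insert(1,2)] mult.assoc insert.IH[folded h_def] ..
qed (simp cong del: D_simp_cong)

lemma D_commute:
  assumes "smooth f" "x \<in> U"
  shows "D v (D w f) x = D w (D v f) x"
proof -
  \<comment> \<open>The points other than \<open>x\<close> at which the expanded commutator
    evaluates its argument.\<close>
  define A where "A = (\<lambda>(\<alpha>, \<beta>). root_reflection \<beta> (root_reflection \<alpha> x)) ` (P \<times> P) - {x}"
  have A: "finite A" by (simp add: A_def)
  \<comment> \<open>The factor for \<open>p\<close> is \<open>(x - p) \<bullet> (y - p)\<close>: it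
    vanishes at \<open>y = p\<close> and is the squared distance from \<open>p\<close> at
    \<open>y = x\<close>.\<close>
  define q where "q y = (\<Prod>p\<in>A. complex_of_real ((x - p) \<bullet> y + - ((x - p) \<bullet> p)))" for y
  have "smooth q" unfolding q_def[abs_def]
    using A by (induction A) auto
  then have "smooth (\<lambda>y. q y * f y)" using assms by simp
  note expand = D_commutator_expansion[OF this assms(2)]
  have "D v (D w (\<lambda>y. q y * f y)) x - D w (D v (\<lambda>y. q y * f y)) x = 0"
    unfolding expand
  proof (intro sum.neutral ballI)
    fix \<alpha> \<beta> assume P: "\<alpha> \<in> P" "\<beta> \<in> P"
    show "g \<alpha> * g \<beta> * of_real ((\<alpha> \<bullet> v) * (\<beta> \<bullet> w) - (\<alpha> \<bullet> w) * (\<beta> \<bullet> v)) / (of_real (\<alpha> \<bullet> x) * of_real (\<beta> \<bullet> root_reflection \<alpha> x))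
      * (q (root_reflection \<beta> (root_reflection \<alpha> x)) * f (root_reflection \<beta> (root_reflection \<alpha> x))) = 0"
    \<comment> \<open>For equal roots the antisymmetrized coefficient is zero; for different ones
      the evaluation point lies in \<open>A\<close>, where \<open>q\<close> vanishes.\<close>
    proof (cases "\<alpha> = \<beta>")
      case False
      then have "root_reflection \<beta> (root_reflection \<alpha> x) \<in> A"
        using refl_refl_fixed[OF P assms(2)] P by (auto simp: A_def)
      then have "q (root_reflection \<beta> (root_reflection \<alpha> x)) = 0"
        unfolding q_def using A by (auto simp: prod_zero_iff)
      then show ?thesis by simp
    qed (simp add: mult.commute)
  qed
  moreover have "D v (D w (\<lambda>y. q y * f y)) x - D w (D v (\<lambda>y. q y * f y)) x
    = q x * (D v (D w f) x - D w (D v f) x)"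
    unfolding q_def by (rule D_commutator_prod_mult[OF assms A])
  moreover have "q x \<noteq> 0"
  proof -
    have "(x - p) \<bullet> x + - ((x - p) \<bullet> p) \<noteq> 0" if "p \<in> A" for p
    proof -
      have "(x - p) \<bullet> x + - ((x - p) \<bullet> p) = (x - p) \<bullet> (x - p)" by (simp add: inner_diff_right)
      then show ?thesis using that by (auto simp: A_def)
    qed
    then show ?thesis unfolding q_def prod_zero_iff[OF A] of_real_eq_0_iff by blast
  qed
  ultimately show ?thesis by simp
qed

section \<open>Laplacian and Euler operator\<close>

abbreviation e :: "'n \<Rightarrow> real ^ 'n" where "e i \<equiv> axis i 1"

definition Lap :: "(real ^ 'n \<Rightarrow> complex) \<Rightarrow> real ^ 'n \<Rightarrow> complex" where
  "Lap f x = (\<Sum>j\<in>UNIV. D (e j) (D (e j) f) x)"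

definition X_D :: "(real ^ 'n \<Rightarrow> complex) \<Rightarrow> real ^ 'n \<Rightarrow> complex" where
  "X_D f x = (\<Sum>j\<in>UNIV. of_real (x $ j) * D (e j) f x)"

text \<open>On smooth functions this is the classical Euler operator (\<open>Euler_eq\<close>); the
  form through Dunkl operators gives access to their commutation rules.\<close>

definition Euler :: "(real ^ 'n \<Rightarrow> complex) \<Rightarrow> real ^ 'n \<Rightarrow> complex" where
  "Euler f x = X_D f x - dunkl_S P g f x"

lemma dunkl_S_act: "dunkl_S P g f x = - (\<Sum>\<alpha>\<in>P. g \<alpha> * act \<alpha> f x)"
  by (simp add: dunkl_S_def act_def)

lemma Lap_cong: "x \<in> U \<Longrightarrow> (\<And>y. y \<in> U \<Longrightarrow> f y = h y) \<Longrightarrow> Lap f x = Lap h x"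
  unfolding Lap_def by (intro sum.cong refl D_cong)

lemma smooth_Lap [simp]: "smooth f \<Longrightarrow> smooth (Lap f)"
  unfolding Lap_def[abs_def] by simp

lemma smooth_X_D [simp]: "smooth f \<Longrightarrow> smooth (X_D f)"
  unfolding X_D_def[abs_def] by simp

lemma smooth_S [simp]: "smooth f \<Longrightarrow> smooth (dunkl_S P g f)"
  unfolding dunkl_S_act[abs_def] by simp

lemma smooth_Euler [simp]: "smooth f \<Longrightarrow> smooth (Euler f)"
  unfolding Euler_def[abs_def] by simp

text \<open>In direction \<open>x\<close> the numerators \<open>\<alpha> \<bullet> x\<close> cancel
  the denominators, so the reflection part of \<open>D x f\<close> is exactly
  \<open>dunkl_S P g f\<close>.\<close>

lemma Euler_eq: "smooth f \<Longrightarrow> x \<in> U \<Longrightarrow> Euler f x = fd f x x"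
proof -
  assume *: "smooth f" "x \<in> U"
  have "X_D f x = D x f x" unfolding X_D_def by (rule D_basis_sum[OF *])
  moreover have "(\<Sum>\<alpha>\<in>P. g \<alpha> * of_real (\<alpha> \<bullet> x) / of_real (\<alpha> \<bullet> x) * act \<alpha> f x)
    = (\<Sum>\<alpha>\<in>P. g \<alpha> * act \<alpha> f x)"
    using U_inner[OF *(2)] by (intro sum.cong) auto
  ultimately show ?thesis by (simp add: Euler_def dunkl_S_act D_def)
qed

lemma Euler_mult:
  assumes "smooth f" "smooth h" "x \<in> U"
  shows "Euler (\<lambda>y. f y * h y) x = f x * Euler h x + Euler f x * h x"
proof -
  have "fd (\<lambda>y. f y * h y) x x = f x * fd h x x + fd f x x * h x"
    by (rule fd_has_derivative, rule has_derivative_mult) (auto intro: smooth_deriv assms)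
  then show ?thesis using assms by (simp add: Euler_eq)
qed

lemma Euler_add:
  "smooth f \<Longrightarrow> smooth h \<Longrightarrow> x \<in> U \<Longrightarrow> Euler (\<lambda>y. f y + h y) x = Euler f x + Euler h x"
  by (simp add: Euler_def X_D_def D_add dunkl_S_def sum.distrib distrib_left)

lemma Euler_diff:
  "smooth f \<Longrightarrow> smooth h \<Longrightarrow> x \<in> U \<Longrightarrow> Euler (\<lambda>y. f y - h y) x = Euler f x - Euler h x"
  by (simp add: Euler_def X_D_def D_diff dunkl_S_def sum_subtractf right_diff_distrib)

lemma Euler_cmult: "smooth f \<Longrightarrow> x \<in> U \<Longrightarrow> Euler (\<lambda>y. c * f y) x = c * Euler f x"
  using Euler_mult[of "\<lambda>x. c" f x] by (simp add: Euler_eq)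

lemma Euler_cong:
  assumes "x \<in> U" "\<And>y. y \<in> U \<Longrightarrow> f y = h y"
  shows "Euler f x = Euler h x"
proof -
  have "D v f x = D v h x" for v by (rule D_cong[OF assms])
  then show ?thesis
    using assms by (simp add: Euler_def X_D_def dunkl_S_def cong del: D_simp_cong)
qed

section \<open>Commutators of the Dunkl Laplacian and the Euler operator\<close>

text \<open>After exchanging the sums, expanding \<alpha> in the standard basis assembles the
  coordinate operators into \<open>D \<alpha>\<close>.\<close>

lemma sum_T_D:
  assumes "smooth f" "x \<in> U"
  shows "(\<Sum>j\<in>UNIV. T (e j) u (D (e j) f) x)
    = D u f x + (\<Sum>\<alpha>\<in>P. g \<alpha> * of_real (2 * (\<alpha> \<bullet> u) / (\<alpha> \<bullet> \<alpha>)) * act \<alpha> (D \<alpha> f) x)"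
proof -
  have a: "act \<alpha> (D \<alpha> f) x = (\<Sum>j\<in>UNIV. of_real (\<alpha> $ j) * act \<alpha> (D (e j) f) x)" if "\<alpha> \<in> P" for \<alpha>
    unfolding act_def using assms that by (intro D_basis_sum[symmetric]) auto
  have "(\<Sum>j\<in>UNIV. \<Sum>\<alpha>\<in>P. g \<alpha> * of_real (2 * (\<alpha> \<bullet> e j) * (\<alpha> \<bullet> u) / (\<alpha> \<bullet> \<alpha>)) * act \<alpha> (D (e j) f) x)
    = (\<Sum>\<alpha>\<in>P. \<Sum>j\<in>UNIV. g \<alpha> * of_real (2 * (\<alpha> \<bullet> e j) * (\<alpha> \<bullet> u) / (\<alpha> \<bullet> \<alpha>)) * act \<alpha> (D (e j) f) x)"
    by (rule sum.swap)
  also have "\<dots> = (\<Sum>\<alpha>\<in>P. g \<alpha> * of_real (2 * (\<alpha> \<bullet> u) / (\<alpha> \<bullet> \<alpha>)) * act \<alpha> (D \<alpha> f) x)"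
    by (rule sum.cong[OF refl]) (simp add: a sum_distrib_left inner_axis divide_inverse algebra_simps)
  finally show ?thesis
    unfolding T_def sum.distrib
    using D_basis_sum[OF assms, of u]
      by (simp add: inner_axis' del: of_real_mult of_real_divide cong del: D_simp_cong)
qed

lemma sum_inner_axis_square:
  "(\<Sum>j\<in>UNIV. complex_of_real (\<alpha> \<bullet> e j) * of_real (\<alpha> \<bullet> e j)) = of_real (\<alpha> \<bullet> \<alpha>)"
  by (simp add: inner_vec_def[of \<alpha> \<alpha>] inner_axis)

text \<open>Commuting \<open>D\<close> past \<open>T\<close> subtracts twice the reflection sum of
  \<open>sum_T_D\<close>, because the squared coordinates of \<alpha> add up to
  \<open>\<alpha> \<bullet> \<alpha>\<close>; this flips its sign.\<close>

lemma sum_D_T: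
  assumes "smooth f" "x \<in> U"
  shows "(\<Sum>j\<in>UNIV. D (e j) (T (e j) u f) x)
    = D u f x - (\<Sum>\<alpha>\<in>P. g \<alpha> * of_real (2 * (\<alpha> \<bullet> u) / (\<alpha> \<bullet> \<alpha>)) * act \<alpha> (D \<alpha> f) x)"
proof -
  have "(\<Sum>j\<in>UNIV. \<Sum>\<alpha>\<in>P. g \<alpha> * of_real (4 * ((\<alpha> \<bullet> e j) * (\<alpha> \<bullet> e j)) * (\<alpha> \<bullet> u) / (\<alpha> \<bullet> \<alpha>)\<^sup>2) * act \<alpha> (D \<alpha> f) x)
    = (\<Sum>\<alpha>\<in>P. \<Sum>j\<in>UNIV. g \<alpha> * of_real (4 * ((\<alpha> \<bullet> e j) * (\<alpha> \<bullet> e j)) * (\<alpha> \<bullet> u) / (\<alpha> \<bullet> \<alpha>)\<^sup>2) * act \<alpha> (D \<alpha> f) x)"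
    by (rule sum.swap)
  also have "\<dots> = (\<Sum>\<alpha>\<in>P. 2 * (g \<alpha> * of_real (2 * (\<alpha> \<bullet> u) / (\<alpha> \<bullet> \<alpha>)) * act \<alpha> (D \<alpha> f) x))"
  proof (rule sum.cong[OF refl])
    fix \<alpha> assume "\<alpha> \<in> P"
    then have nz: "complex_of_real (\<alpha> \<bullet> \<alpha>) \<noteq> 0" using P_nonzero by simp
    have "(\<Sum>j\<in>UNIV. g \<alpha> * of_real (4 * ((\<alpha> \<bullet> e j) * (\<alpha> \<bullet> e j)) * (\<alpha> \<bullet> u) / (\<alpha> \<bullet> \<alpha>)\<^sup>2) * act \<alpha> (D \<alpha> f) x)
      = (\<Sum>j\<in>UNIV. complex_of_real (\<alpha> \<bullet> e j) * of_real (\<alpha> \<bullet> e j))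
      * (g \<alpha> * of_real (4 * (\<alpha> \<bullet> u) / (\<alpha> \<bullet> \<alpha>)\<^sup>2) * act \<alpha> (D \<alpha> f) x)"
      unfolding sum_distrib_right by (rule sum.cong) (simp_all add: divide_inverse algebra_simps)
    also have "\<dots> = 2 * (g \<alpha> * of_real (2 * (\<alpha> \<bullet> u) / (\<alpha> \<bullet> \<alpha>)) * act \<alpha> (D \<alpha> f) x)"
      unfolding sum_inner_axis_square using nz by (simp add: power2_eq_square)
    finally show "(\<Sum>j\<in>UNIV. g \<alpha> * of_real (4 * ((\<alpha> \<bullet> e j) * (\<alpha> \<bullet> e j)) * (\<alpha> \<bullet> u) / (\<alpha> \<bullet> \<alpha>)\<^sup>2) * act \<alpha> (D \<alpha> f) x)
      = 2 * (g \<alpha> * of_real (2 * (\<alpha> \<bullet> u) / (\<alpha> \<bullet> \<alpha>)) * act \<alpha> (D \<alpha> f) x)" .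
  qed
  finally show ?thesis
    unfolding D_T_commutator[OF assms] sum_subtractf sum_T_D[OF assms]
    by (simp add: sum_distrib_left[symmetric] del: of_real_mult of_real_divide cong del: D_simp_cong)
qed

text \<open>The reflection sums of \<open>sum_T_D\<close> and \<open>sum_D_T\<close> are opposite,
  leaving the same first-order term as for the ordinary Laplacian.\<close>

lemma Lap_inner_mult:
  assumes "smooth f" "x \<in> U"
  shows "Lap (\<lambda>y. of_real (u \<bullet> y) * f y) x = of_real (u \<bullet> x) * Lap f x + 2 * D u f x"
proof -
  have "D v (D v (\<lambda>y. of_real (u \<bullet> y) * f y)) x
    = of_real (u \<bullet> x) * D v (D v f) x + (T v u (D v f) x + D v (T v u f) x)" for v
  proof -
    have "D v (D v (\<lambda>y. of_real (u \<bullet> y) * f y)) x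
      = D v (\<lambda>y. of_real (u \<bullet> y) * D v f y + T v u f y) x"
      by (rule D_cong[OF assms(2)]) (rule D_inner_mult[OF assms(1)])
    also have "\<dots> = of_real (u \<bullet> x) * D v (D v f) x + (T v u (D v f) x + D v (T v u f) x)"
      using assms by (simp add: D_add D_inner_mult)
    finally show ?thesis .
  qed
  then show ?thesis
    unfolding Lap_def by (simp add: sum.distrib sum_distrib_left sum_T_D sum_D_T assms)
qed

lemma Lap_coord_mult:
  assumes "smooth f" "x \<in> U"
  shows "Lap (\<lambda>y. of_real (y $ i) * f y) x = of_real (x $ i) * Lap f x + 2 * D (e i) f x"
  using Lap_inner_mult[OF assms, of "e i"] by (simp add: inner_axis')

lemma D_coord_mult:
  assumes "smooth f" "x \<in> U"
  shows "D v (\<lambda>y. of_real (y $ i) * f y) x = of_real (x $ i) * D v f x + T v (e i) f x"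
  using D_inner_mult[OF assms, of v "e i"] by (simp add: inner_axis' cong del: D_simp_cong)

lemma Lap_add: "smooth f \<Longrightarrow> smooth h \<Longrightarrow> x \<in> U \<Longrightarrow> Lap (\<lambda>y. f y + h y) x = Lap f x + Lap h x"
  unfolding Lap_def by (simp add: D_add sum.distrib)

lemma Lap_diff: "smooth f \<Longrightarrow> smooth h \<Longrightarrow> x \<in> U \<Longrightarrow> Lap (\<lambda>y. f y - h y) x = Lap f x - Lap h x"
  unfolding Lap_def by (simp add: D_diff sum_subtractf)

lemma Lap_cmult: "smooth f \<Longrightarrow> x \<in> U \<Longrightarrow> Lap (\<lambda>y. c * f y) x = c * Lap f x"
  unfolding Lap_def by (simp add: D_cmult sum_distrib_left)

lemma Lap_D: "smooth f \<Longrightarrow> x \<in> U \<Longrightarrow> Lap (D v f) x = D v (Lap f) x"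
proof -
  assume *: "smooth f" "x \<in> U"
  have "D (e j) (D (e j) (D v f)) x = D v (D (e j) (D (e j) f)) x" for j
  proof -
    have "D (e j) (D (e j) (D v f)) x = D (e j) (D v (D (e j) f)) x"
      using * by (intro D_cong) (simp_all add: D_commute)
    also have "\<dots> = D v (D (e j) (D (e j) f)) x"
      using * by (intro D_commute) simp_all
    finally show ?thesis .
  qed
  then show ?thesis unfolding Lap_def[abs_def] using * by (subst D_sum) simp_all
qed

lemma D_S:
  assumes "smooth f" "x \<in> U"
  shows "D v (dunkl_S P g f) x
    = dunkl_S P g (D v f) x + (\<Sum>\<alpha>\<in>P. g \<alpha> * of_real (2 * (\<alpha> \<bullet> v) / (\<alpha> \<bullet> \<alpha>)) * act \<alpha> (D \<alpha> f) x)"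
proof -
  have "D v (dunkl_S P g f) x = D v (\<lambda>y. - (\<Sum>\<alpha>\<in>P. g \<alpha> * act \<alpha> f y)) x"
    by (rule D_cong[OF assms(2)]) (rule dunkl_S_act)
  also have "\<dots> = - (\<Sum>\<alpha>\<in>P. g \<alpha> * D v (act \<alpha> f) x)"
    using assms by (simp add: D_uminus D_sum D_cmult)
  also have "\<dots> = dunkl_S P g (D v f) x
    + (\<Sum>\<alpha>\<in>P. g \<alpha> * of_real (2 * (\<alpha> \<bullet> v) / (\<alpha> \<bullet> \<alpha>)) * act \<alpha> (D \<alpha> f) x)"
    using assms
    by (simp add: D_act_commutator dunkl_S_act sum_subtractf right_diff_distrib mult.assoc
        del: of_real_mult of_real_divide cong del: D_simp_cong)
  finally show "D v (dunkl_S P g f) x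
    = dunkl_S P g (D v f) x + (\<Sum>\<alpha>\<in>P. g \<alpha> * of_real (2 * (\<alpha> \<bullet> v) / (\<alpha> \<bullet> \<alpha>)) * act \<alpha> (D \<alpha> f) x)" .
qed


text \<open>The reflection sum produced by differentiating the coordinates in \<open>X_D\<close>
  (\<open>sum_T_D\<close>) equals the one produced by \<open>dunkl_S\<close> (\<open>D_S\<close>),
  and the two cancel.\<close>

lemma D_Euler:
  assumes "smooth f" "x \<in> U"
  shows "D v (Euler f) x = Euler (D v f) x + D v f x"
proof -
  have "D v (X_D f) x = (\<Sum>j\<in>UNIV. of_real (x $ j) * D v (D (e j) f) x + T v (e j) (D (e j) f) x)"
    unfolding X_D_def[abs_def] using assms by (simp add: D_sum D_coord_mult)
  also have "\<dots> = X_D (D v f) x + (\<Sum>j\<in>UNIV. T (e j) v (D (e j) f) x)"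
  proof -
    have "D v (D (e j) f) x = D (e j) (D v f) x" for j by (rule D_commute[OF assms])
    \<comment> \<open>\<open>T\<close> is symmetric in its two directions, which brings the sum into
      the form of \<open>sum_T_D\<close>.\<close>
    moreover have "T v (e j) h x
      = T (e j) v h x" for j h by (simp add: T_def inner_commute mult.left_commute mult.commute)
    ultimately show ?thesis by (simp add: X_D_def sum.distrib cong del: D_simp_cong)
  qed
  finally have 1: "D v (X_D f) x = X_D (D v f) x + (\<Sum>j\<in>UNIV. T (e j) v (D (e j) f) x)" .
  have "D v (Euler f) x = D v (X_D f) x - D v (dunkl_S P g f) x"
    unfolding Euler_def[abs_def] using assms by (simp add: D_diff cong del: D_simp_cong)
  then show ?thesis unfolding 1 D_S[OF assms] sum_T_D[OF assms] by (simp add: Euler_def)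
qed

lemma Lap_Euler:
  assumes "smooth f" "x \<in> U"
  shows "Lap (Euler f) x = Euler (Lap f) x + 2 * Lap f x"
proof -
  have "D v (D v (Euler f)) x = Euler (D v (D v f)) x + 2 * D v (D v f) x" for v
  proof -
    have "D v (D v (Euler f)) x = D v (\<lambda>y. Euler (D v f) y + D v f y) x"
      by (rule D_cong[OF assms(2)]) (rule D_Euler[OF assms(1)])
    then show ?thesis using assms by (simp add: D_add D_Euler cong del: D_simp_cong)
  qed
  moreover have "Euler (Lap f) x = (\<Sum>j\<in>UNIV. Euler (D (e j) (D (e j) f)) x)"
  proof -
    have "Euler (\<lambda>y. \<Sum>j\<in>A. D (e j) (D (e j) f) y) x = (\<Sum>j\<in>A. Euler (D (e j) (D (e j) f)) x)"
      if "finite A" for A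
      using that
    proof induction
      case empty show ?case using Euler_cmult[of "\<lambda>x. 0" x 0] assms by simp
    next
      case (insert a A)
      then show ?case using assms by (simp add: Euler_add cong del: D_simp_cong)
    qed
    then show ?thesis by (simp add: Lap_def[abs_def] cong del: D_simp_cong)
  qed
  ultimately show ?thesis by (simp add: Lap_def sum.distrib sum_distrib_left)
qed

section \<open>The Coulomb problem\<close>

definition \<rho> :: "real ^ 'n \<Rightarrow> complex" where "\<rho> x = 1 / of_real (norm x)"

lemma smooth_rho [simp]: "smooth \<rho>"
  unfolding \<rho>_def[abs_def] by simp

lemma smooth_power [simp]: "smooth f \<Longrightarrow> smooth (\<lambda>x. f x ^ n)"
  by (induction n) simp_all

lemma rho_inner: "x \<in> U \<Longrightarrow> of_real (x \<bullet> x) * \<rho> x ^ 2 = 1"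
  using U_nonzero[of x] by (simp add: \<rho>_def power_divide power2_norm_eq_inner[symmetric])

lemma fd_rho_power:
  assumes "x \<in> U"
  shows "fd (\<lambda>y. \<rho> y ^ n) x v = - of_nat n * of_real (v \<bullet> x) * \<rho> x ^ (n + 2)"
proof -
  have "(\<rho> has_derivative (\<lambda>v. - of_real (v \<bullet> x) * \<rho> x ^ 3)) (at x)"
    unfolding \<rho>_def[abs_def] by (rule has_derivative_inverse_norm[OF U_nonzero[OF assms]])
  then have "((\<lambda>y. \<rho> y ^ n) has_derivative (\<lambda>v. of_nat n * (- of_real (v \<bullet> x) * \<rho> x ^ 3) * \<rho> x ^ (n - 1))) (at x)"
    by (rule has_derivative_power)
  then have "fd (\<lambda>y. \<rho> y ^ n) x v = of_nat n * (- of_real (v \<bullet> x) * \<rho> x ^ 3) * \<rho> x ^ (n - 1)"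
    by (rule fd_has_derivative)
  \<comment> \<open>For \<open>n = 0\<close> the factor \<open>of_nat n\<close> annihilates both
    sides; otherwise the exponents 3 and \<open>n - 1\<close> add up to
    \<open>n + 2\<close>.\<close>
  then show ?thesis by (cases n) (simp_all add: power_add power3_eq_cube power2_eq_square algebra_simps)
qed

text \<open>Homogeneity of degree \<open>- n\<close>; \<open>rho_inner\<close> absorbs the two extra
  powers from the derivative.\<close>

lemma Euler_rho_power: "x \<in> U \<Longrightarrow> Euler (\<lambda>y. \<rho> y ^ n) x = - of_nat n * \<rho> x ^ n"
  using rho_inner[of x] by (simp add: Euler_eq fd_rho_power power_add power2_eq_square ac_simps)

lemma D_rho_power:
  assumes "smooth f" "x \<in> U"
  shows "D v (\<lambda>y. \<rho> y ^ n * f y) x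
    = \<rho> x ^ n * D v f x - of_nat n * of_real (v \<bullet> x) * \<rho> x ^ (n + 2) * f x"
proof -
  have "D v (\<lambda>y. \<rho> y ^ n * f y) x = \<rho> x ^ n * D v f x + fd (\<lambda>y. \<rho> y ^ n) x v * f x"
    by (rule D_invariant_mult) (simp_all add: assms \<rho>_def)
  then show ?thesis by (simp add: fd_rho_power[OF assms(2)])
qed

lemma D_rho:
  assumes "smooth f" "x \<in> U"
  shows "D (e j) (\<lambda>y. \<rho> y * f y) x = \<rho> x * D (e j) f x - of_real (x $ j) * (\<rho> x ^ 3 * f x)"
  using D_rho_power[OF assms, of "e j" 1]
  by (simp add: inner_axis' mult.assoc numeral_3_eq_3 cong del: D_simp_cong)

text \<open>In the trace over directions each root contributes 2, since its squared coordinates sum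
  to \<open>\<alpha> \<bullet> \<alpha>\<close>.\<close>

lemma sum_T_diag: "(\<Sum>j\<in>UNIV. T (e j) (e j) f x) = of_nat CARD('n) * f x - 2 * dunkl_S P g f x"
proof -
  have "(\<Sum>j\<in>UNIV. \<Sum>\<alpha>\<in>P. g \<alpha> * of_real (2 * (\<alpha> \<bullet> e j) * (\<alpha> \<bullet> e j) / (\<alpha> \<bullet> \<alpha>)) * act \<alpha> f x)
    = (\<Sum>\<alpha>\<in>P. \<Sum>j\<in>UNIV. g \<alpha> * of_real (2 * (\<alpha> \<bullet> e j) * (\<alpha> \<bullet> e j) / (\<alpha> \<bullet> \<alpha>)) * act \<alpha> f x)"
    by (rule sum.swap)
  also have "\<dots> = (\<Sum>\<alpha>\<in>P. 2 * (g \<alpha> * act \<alpha> f x))"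
  proof (rule sum.cong[OF refl])
    fix \<alpha> assume "\<alpha> \<in> P"
    then have nz: "complex_of_real (\<alpha> \<bullet> \<alpha>) \<noteq> 0" using P_nonzero by simp
    have "(\<Sum>j\<in>UNIV. g \<alpha> * of_real (2 * (\<alpha> \<bullet> e j) * (\<alpha> \<bullet> e j) / (\<alpha> \<bullet> \<alpha>)) * act \<alpha> f x)
      = (\<Sum>j\<in>UNIV. complex_of_real (\<alpha> \<bullet> e j) * of_real (\<alpha> \<bullet> e j))
      * (g \<alpha> * of_real (2 / (\<alpha> \<bullet> \<alpha>)) * act \<alpha> f x)"
      unfolding sum_distrib_right by (rule sum.cong) (simp_all add: divide_inverse algebra_simps)
    also have "\<dots> = 2 * (g \<alpha> * act \<alpha> f x)"
      unfolding sum_inner_axis_square using nz by simp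
    finally show "(\<Sum>j\<in>UNIV. g \<alpha> * of_real (2 * (\<alpha> \<bullet> e j) * (\<alpha> \<bullet> e j) / (\<alpha> \<bullet> \<alpha>)) * act \<alpha> f x)
      = 2 * (g \<alpha> * act \<alpha> f x)" .
  qed
  finally show ?thesis
    unfolding T_def sum.distrib
    by (simp add: dunkl_S_act sum_distrib_left[symmetric] del: of_real_mult of_real_divide)
qed

text \<open>Two uses of the product rule give \<open>X_D\<close> terms, and the trace of
  \<open>T\<close> gives the \<open>dunkl_S\<close> term that completes them to
  \<open>Euler\<close>. In the last coefficient, 3 comes from differentiating the cube and the
  dimension from the trace.\<close>

lemma Lap_rho:
  assumes "smooth f" "x \<in> U"
  shows "Lap (\<lambda>y. \<rho> y * f y) x
    = \<rho> x * Lap f x - 2 * \<rho> x ^ 3 * Euler f x + (3 - of_nat CARD('n)) * \<rho> x ^ 3 * f x"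
proof -
  define h where "h y = \<rho> y ^ 3 * f y" for y
  have h: "smooth h" unfolding h_def[abs_def] using assms by simp
  have Dh: "D (e j) h x = \<rho> x ^ 3 * D (e j) f x - 3 * of_real (x $ j) * \<rho> x ^ 5 * f x" for j
    unfolding h_def[abs_def] D_rho_power[OF assms] by (simp add: inner_axis')
  have term_j: "D (e j) (D (e j) (\<lambda>y. \<rho> y * f y)) x
    = \<rho> x * D (e j) (D (e j) f) x - 2 * (\<rho> x ^ 3 * (of_real (x $ j) * D (e j) f x))
      + (of_real (x $ j) * of_real (x $ j)) * (3 * \<rho> x ^ 5 * f x) - T (e j) (e j) h x" for j
  proof -
    have "D (e j) (D (e j) (\<lambda>y. \<rho> y * f y)) x
      = D (e j) (\<lambda>y. \<rho> y * D (e j) f y - of_real (y $ j) * h y) x"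
      unfolding h_def by (rule D_cong[OF assms(2)]) (rule D_rho[OF assms(1)])
    also have "\<dots> = \<rho> x * D (e j) (D (e j) f) x - of_real (x $ j) * (\<rho> x ^ 3 * D (e j) f x)
       - (of_real (x $ j) * D (e j) h x + T (e j) (e j) h x)"
      using assms h by (simp add: D_diff D_rho D_coord_mult)
    finally show ?thesis unfolding Dh by (simp add: algebra_simps)
  qed
  have r: "(\<Sum>j\<in>UNIV. complex_of_real (x $ j) * of_real (x $ j)) = of_real (x \<bullet> x)"
    by (simp add: inner_vec_def)
  have S: "dunkl_S P g h x = \<rho> x ^ 3 * dunkl_S P g f x"
    by (simp add: dunkl_S_def h_def \<rho>_def sum_distrib_left mult.left_commute)
  have 5: "of_real (x \<bullet> x) * (3 * \<rho> x ^ 5 * f x) = 3 * \<rho> x ^ 3 * f x"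
  proof -
    have "of_real (x \<bullet> x) * (3 * \<rho> x ^ 5 * f x) = (of_real (x \<bullet> x) * \<rho> x ^ 2) * (3 * \<rho> x ^ 3 * f x)"
      by (simp add: power_add[of _ 2 3, simplified])
    then show ?thesis unfolding rho_inner[OF assms(2)] by simp
  qed
  have "Lap (\<lambda>y. \<rho> y * f y) x = \<rho> x * Lap f x - 2 * (\<rho> x ^ 3 * X_D f x)
      + of_real (x \<bullet> x) * (3 * \<rho> x ^ 5 * f x) - (of_nat CARD('n) * h x - 2 * dunkl_S P g h x)"
    unfolding Lap_def term_j sum.distrib sum_subtractf sum_T_diag X_D_def r[symmetric]
    by (simp add: sum_distrib_left sum_distrib_right)
  then show ?thesis
    unfolding 5 S Euler_def by (simp add: h_def algebra_simps)
qed

section \<open>Commutation in normal form\<close>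

definition LRL :: "complex \<Rightarrow> 'n \<Rightarrow> (real ^ 'n \<Rightarrow> complex) \<Rightarrow> real ^ 'n \<Rightarrow> complex" where
  "LRL \<gamma> i f x = Euler (D (e i) f) x + (of_nat CARD('n) - 1) / 2 * D (e i) f x
     - of_real (x $ i) * Lap f x - \<gamma> * (of_real (x $ i) * (\<rho> x * f x))"

definition Ham :: "complex \<Rightarrow> (real ^ 'n \<Rightarrow> complex) \<Rightarrow> real ^ 'n \<Rightarrow> complex" where
  "Ham \<gamma> f x = Lap f x + 2 * \<gamma> * (\<rho> x * f x)"

lemma smooth_LRL [simp]: "smooth f \<Longrightarrow> smooth (LRL \<gamma> i f)"
  and smooth_Ham [simp]: "smooth f \<Longrightarrow> smooth (Ham \<gamma> f)"
  unfolding LRL_def[abs_def] Ham_def[abs_def] by simp_all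

lemma LRL_cong:
  assumes "x \<in> U" "\<And>y. y \<in> U \<Longrightarrow> f y = h y"
  shows "LRL \<gamma> i f x = LRL \<gamma> i h x"
proof -
  have "Euler (D (e i) f) x = Euler (D (e i) h) x"
    by (intro Euler_cong D_cong assms)
  moreover have "Lap f x = Lap h x" by (intro Lap_cong assms)
  moreover have "D (e i) f x = D (e i) h x" by (intro D_cong assms)
  ultimately show ?thesis using assms by (simp add: LRL_def cong del: D_simp_cong)
qed

lemma Ham_cong:
  assumes "x \<in> U" "\<And>y. y \<in> U \<Longrightarrow> f y = h y"
  shows "Ham \<gamma> f x = Ham \<gamma> h x"
  using Lap_cong[of x f h] assms by (simp add: Ham_def)

text \<open>Powers of \<gamma> are compared. At order zero the terms \<open>2 * ?D (Lap f) x\<close>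
  from \<open>Lap_Euler\<close> and \<open>Lap_coord_mult\<close> cancel; at order two both sides
  are the same multiplication; at order one the formulas for \<open>F\<close> balance.\<close>

lemma LRL_Ham_commute:
  assumes "smooth f" "x \<in> U"
  shows "LRL \<gamma> i (Ham \<gamma> f) x = Ham \<gamma> (LRL \<gamma> i f) x"
proof -
  define c :: complex where "c = (of_nat CARD('n) - 1) / 2"
  define F where "F y = \<rho> y * f y" for y
  have F: "smooth F" unfolding F_def[abs_def] using assms by simp
  let ?D = "D (e i)"
  define X where "X = complex_of_real (x $ i)"
  define r where "r = \<rho> x"
  \<comment> \<open>In terms of \<open>c\<close> the coefficient 3 minus the dimension is
    \<open>2 - 2 * c\<close>; this relation makes the \<open>r ^ 3 * f x\<close> terms
    balance.\<close>
  have LF: "Lap F x = r * Lap f x - 2 * r ^ 3 * Euler f x + (2 - 2 * c) * r ^ 3 * f x"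
  proof -
    have "3 - of_nat CARD('n) = 2 - 2 * c" by (simp add: c_def field_simps)
    then show ?thesis unfolding F_def[abs_def] Lap_rho[OF assms] by (simp only: r_def)
  qed
  have DF: "?D F y = \<rho> y * ?D f y - of_real (y $ i) * (\<rho> y ^ 3 * f y)" if "y \<in> U" for y
    unfolding F_def[abs_def] D_rho[OF assms(1) that] by simp
  have Ecoord: "Euler (\<lambda>y. of_real (y $ i)) x = X"
  proof -
    have "fd (\<lambda>y. of_real (y $ i)) x x = X"
      unfolding X_def
      by (rule fd_has_derivative)
         (intro has_derivative_of_real bounded_linear_imp_has_derivative[OF bounded_linear_vec_nth])
    then show ?thesis by (simp add: Euler_eq assms)
  qed
  \<comment> \<open>\<open>Euler\<close> is a derivation acting on \<open>\<rho>\<close>, the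
    coordinate and \<open>\<rho> ^ 3\<close> by the degrees -1, 1 and -3; the coefficient 2 is -(1 -
    3).\<close>
  have EDF: "Euler (?D F) x = r * Euler (?D f) x - r * ?D f x - X * (r ^ 3 * Euler f x)
    + 2 * X * (r ^ 3 * f x)"
  proof -
    have "Euler (?D F) x = Euler (\<lambda>y. \<rho> y * ?D f y - of_real (y $ i) * (\<rho> y ^ 3 * f y)) x"
      using assms(2) DF by (rule Euler_cong)
    also have "\<dots> = Euler (\<lambda>y. \<rho> y * ?D f y) x - Euler (\<lambda>y. of_real (y $ i) * (\<rho> y ^ 3 * f y)) x"
      using assms by (intro Euler_diff) simp_all
    also have "\<dots> = r * Euler (?D f) x - r * ?D f x - X * (r ^ 3 * Euler f x)
      + 2 * X * (r ^ 3 * f x)"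
      using assms Euler_rho_power[OF assms(2), of 1] Euler_rho_power[OF assms(2), of 3]
      by (simp add: Euler_mult Ecoord r_def X_def algebra_simps)
    finally show ?thesis .
  qed
  have Ham: "Ham \<gamma> f = (\<lambda>y. Lap f y + 2 * \<gamma> * F y)"
    by (simp add: Ham_def fun_eq_iff F_def)
  have "Euler (?D (Ham \<gamma> f)) x = Euler (\<lambda>y. ?D (Lap f) y + 2 * \<gamma> * ?D F y) x"
    unfolding Ham by (rule Euler_cong[OF assms(2)]) (simp add: D_add D_cmult assms F)
  also have "\<dots> = Euler (?D (Lap f)) x + 2 * \<gamma> * Euler (?D F) x"
    using assms F by (simp add: Euler_add Euler_cmult)
  finally have EH: "Euler (?D (Ham \<gamma> f)) x = Euler (?D (Lap f)) x + 2 * \<gamma> * Euler (?D F) x" .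
  have DH: "?D (Ham \<gamma> f) x = ?D (Lap f) x + 2 * \<gamma> * ?D F x"
    unfolding Ham using assms F by (simp add: D_add D_cmult)
  have LH: "Lap (Ham \<gamma> f) x = Lap (Lap f) x + 2 * \<gamma> * Lap F x"
    unfolding Ham using assms F by (simp add: Lap_add Lap_cmult)
  have "LRL \<gamma> i f = (\<lambda>y. Euler (?D f) y + c * ?D f y - of_real (y $ i) * Lap f y
     - \<gamma> * (of_real (y $ i) * F y))"
    by (simp add: LRL_def fun_eq_iff F_def c_def)
  then have "Lap (LRL \<gamma> i f) x = Lap (Euler (?D f)) x + c * Lap (?D f) x
     - Lap (\<lambda>y. of_real (y $ i) * Lap f y) x - \<gamma> * Lap (\<lambda>y. of_real (y $ i) * F y) x"
    using assms F by (simp add: Lap_add Lap_diff Lap_cmult)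
  also have "Lap (\<lambda>y. of_real (y $ i) * Lap f y) x = X * Lap (Lap f) x + 2 * ?D (Lap f) x"
    unfolding X_def using assms by (intro Lap_coord_mult) simp_all
  also have "Lap (\<lambda>y. of_real (y $ i) * F y) x = X * Lap F x + 2 * ?D F x"
    unfolding X_def using assms F by (intro Lap_coord_mult) simp_all
  also have "Lap (Euler (?D f)) x = Euler (Lap (?D f)) x + 2 * Lap (?D f) x"
    using assms by (intro Lap_Euler) simp_all
  also have "Euler (Lap (?D f)) x = Euler (?D (Lap f)) x"
    using assms by (intro Euler_cong Lap_D) simp_all
  also have "Lap (?D f) x = ?D (Lap f) x" using assms by (intro Lap_D)
  finally have LA: "Lap (LRL \<gamma> i f) x = Euler (?D (Lap f)) x + 2 * ?D (Lap f) x
     + c * ?D (Lap f) x - (X * Lap (Lap f) x + 2 * ?D (Lap f) x) - \<gamma> * (X * Lap F x + 2 * ?D F x)" .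
  have DFx: "?D F x = r * ?D f x - X * (r ^ 3 * f x)"
    using DF[OF assms(2)] by (simp add: r_def X_def)
  show ?thesis
    unfolding LRL_def[of _ _ "Ham \<gamma> f"] Ham_def[of _ "LRL \<gamma> i f"] LA EH DH LH
    unfolding LRL_def Ham_def c_def[symmetric] X_def[symmetric] r_def[symmetric] EDF LF DFx
    by (simp add: algebra_simps)
qed

section \<open>Return to the coordinate operators\<close>

lemma dunkl_eq_D: "smooth f \<Longrightarrow> x \<in> U \<Longrightarrow> dunkl P g i f x = D (e i) f x"
proof -
  assume *: "smooth f" "x \<in> U"
  have d: "((\<lambda>t. x + t *\<^sub>R e i) has_derivative (\<lambda>t. t *\<^sub>R e i)) (at 0)"
    by (auto intro!: derivative_eq_intros)
  have f: "(f has_derivative fd f x) (at (x + 0 *\<^sub>R e i))"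
    using smooth_deriv[OF *] by simp
  have "linear (fd f x)" by (rule has_derivative_linear[OF smooth_deriv[OF *]])
  then have "((\<lambda>t. f (x + t *\<^sub>R e i)) has_vector_derivative fd f x (e i)) (at 0)"
    unfolding has_vector_derivative_def
    using has_derivative_compose[OF d f] by (simp add: linear_scale)
  then have "partial i f x = fd f x (e i)"
    unfolding partial_def by (rule vector_derivative_at)
  then show ?thesis by (simp add: dunkl_def D_def act_def inner_axis)
qed

lemma smooth_dunkl [simp]: "smooth f \<Longrightarrow> smooth (dunkl P g i f)"
  using smooth_on_cong[OF open_U, of "dunkl P g i f" "D (e i) f"] dunkl_eq_D by simp

lemma dunkl_dunkl: "smooth f \<Longrightarrow> x \<in> U \<Longrightarrow> dunkl P g i (dunkl P g j f) x = D (e i) (D (e j) f) x"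
  by (simp add: dunkl_eq_D)

lemma dunkl_coulomb_eq: "smooth f \<Longrightarrow> x \<in> U \<Longrightarrow> dunkl_coulomb P g \<gamma> f x = Ham \<gamma> f x"
  by (simp add: dunkl_coulomb_def Ham_def dunkl_laplacian_def dunkl_dunkl Lap_def \<rho>_def)

text \<open>Summing the \<open>T\<close> terms of the anticommutators yields \<open>Q\<close> from
  \<open>sum_T_D\<close> and a \<open>dunkl_S\<close> term from \<open>sum_T_diag\<close>. The
  commutator with \<open>dunkl_S\<close> is again \<open>Q\<close> and removes the former; the
  latter completes \<open>X_D\<close> to \<open>Euler\<close>, and the remaining multiples of
  \<open>?D f x\<close> give \<open>(of_nat CARD('n) - 1) / 2\<close>.\<close>

lemma dunkl_LRL_eq:
  assumes "smooth f" "x \<in> U"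
  shows "dunkl_LRL P g \<gamma> i f x = LRL \<gamma> i f x"
proof -
  define Q where "Q = (\<Sum>\<alpha>\<in>P. g \<alpha> * of_real (2 * (\<alpha> \<bullet> e i) / (\<alpha> \<bullet> \<alpha>)) * act \<alpha> (D \<alpha> f) x)"
  let ?D = "D (e i)"
  have "acomm (dunkl_angular P g i j) (dunkl P g j) f x
    = 2 * (of_real (x $ i) * D (e j) (D (e j) f) x) - 2 * (of_real (x $ j) * D (e j) (?D f) x)
      + T (e j) (e i) (D (e j) f) x - T (e j) (e j) (?D f) x" for j
  proof -
    have ang: "dunkl_angular P g i j f y
      = of_real (y $ i) * D (e j) f y - of_real (y $ j) * ?D f y" if "y \<in> U" for y
      using assms that by (simp add: dunkl_angular_def dunkl_eq_D)
    have "smooth (\<lambda>y. of_real (y $ i) * D (e j) f y - of_real (y $ j) * ?D f y)"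
      using assms by simp
    then have "smooth (dunkl_angular P g i j f)"
      by (subst smooth_on_cong[OF open_U ang])
    then have "dunkl P g j (dunkl_angular P g i j f) x = D (e j) (dunkl_angular P g i j f) x"
      using assms by (simp add: dunkl_eq_D cong del: D_simp_cong)
    also have "\<dots> = D (e j) (\<lambda>y. of_real (y $ i) * D (e j) f y - of_real (y $ j) * ?D f y) x"
      using assms(2) ang by (rule D_cong)
    also have "\<dots> = of_real (x $ i) * D (e j) (D (e j) f) x + T (e j) (e i) (D (e j) f) x
      - (of_real (x $ j) * D (e j) (?D f) x + T (e j) (e j) (?D f) x)"
      using assms by (simp add: D_diff D_coord_mult)
    finally have "dunkl P g j (dunkl_angular P g i j f) x = \<dots>" .
    then show ?thesis
      using assms D_commute[OF assms, of "e i" "e j"]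
      by (simp add: acomm_def dunkl_angular_def dunkl_dunkl cong del: D_simp_cong)
  qed
  then have 1: "(\<Sum>j\<in>UNIV. acomm (dunkl_angular P g i j) (dunkl P g j) f x)
    = 2 * (of_real (x $ i) * Lap f x) - 2 * X_D (?D f) x + (?D f x + Q)
      - (of_nat CARD('n) * ?D f x - 2 * dunkl_S P g (?D f) x)"
    by (simp add: sum.distrib sum_subtractf sum_distrib_left[symmetric] sum_T_diag sum_T_D[OF assms] Q_def
        Lap_def X_D_def del: of_real_mult of_real_divide cong del: D_simp_cong)
  have "dunkl P g i (dunkl_S P g f) x - dunkl_S P g (dunkl P g i f) x
    = D (e i) (dunkl_S P g f) x - dunkl_S P g (?D f) x"
    using assms by (simp add: dunkl_eq_D dunkl_S_def)
  then have 2: "comm (dunkl P g i) (dunkl_S P g) f x = Q"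
    unfolding comm_def D_S[OF assms] Q_def by simp
  show ?thesis
    unfolding dunkl_LRL_def 1 2 LRL_def Euler_def \<rho>_def by (simp add: field_simps)
qed

end

theorem proposition3p5:
  fixes R P :: "(real ^ 'n) set" and g :: "real ^ 'n \<Rightarrow> complex" and \<gamma> :: complex
    and i :: 'n and \<psi> :: "real ^ 'n \<Rightarrow> complex" and x :: "real ^ 'n"
  assumes "root_system R"
    and "positive_roots R P"
    and "multiplicity_function R g"
    and "smooth_on (regular_set R) \<psi>"
    and "x \<in> regular_set R"
  shows "comm (dunkl_LRL P g \<gamma> i) (dunkl_coulomb P g \<gamma>) \<psi> x = 0"
proof -
  interpret dunkl_setting R P g
    by unfold_locales (use assms in auto)
  have H: "dunkl_coulomb P g \<gamma> \<psi> y = Ham \<gamma> \<psi> y" and A: "dunkl_LRL P g \<gamma> i \<psi> y = LRL \<gamma> i \<psi> y"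
    if "y \<in> U" for y
    using assms(4) that by (simp_all only: dunkl_coulomb_eq dunkl_LRL_eq)
  \<comment> \<open>The original operators agree with their normal forms on \<open>U\<close> only.
    Smoothness on \<open>U\<close> transfers, so the outer operators can be identified too;
    \<open>LRL_cong\<close> and \<open>Ham_cong\<close> then replace the inner ones.\<close>
  have sH: "smooth (dunkl_coulomb P g \<gamma> \<psi>)" and sA: "smooth (dunkl_LRL P g \<gamma> i \<psi>)"
    using smooth_on_cong[OF open_U H] smooth_on_cong[OF open_U A] assms(4) by simp_all
  have "dunkl_LRL P g \<gamma> i (dunkl_coulomb P g \<gamma> \<psi>) x = LRL \<gamma> i (Ham \<gamma> \<psi>) x"
    unfolding dunkl_LRL_eq[OF sH assms(5)] using assms(5) H by (rule LRL_cong)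
  moreover have "dunkl_coulomb P g \<gamma> (dunkl_LRL P g \<gamma> i \<psi>) x = Ham \<gamma> (LRL \<gamma> i \<psi>) x"
    unfolding dunkl_coulomb_eq[OF sA assms(5)] using assms(5) A by (rule Ham_cong)
  ultimately show ?thesis
    unfolding comm_def using LRL_Ham_commute[OF assms(4,5)] by simp
qed

end
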